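(* For every fixed $\beta>0$ there exist constants $0<c\le C<\infty$ and $n_0\in\mathbb{N}$, depending only on $\beta$, such that for every integer $n\ge n_0$ and every real $\alpha$ with $\beta\log n\le \alpha\le n$, $$ c\,\frac{\log n}{\log\big(\frac{\alpha}{\log n}+1\big)}\;\le\; k_n^{\alpha}(\ell_\infty)\;\le\; C\,\frac{\log n}{\log\big(\frac{\alpha}{\log n}+1\big)} . $$ That is, $k_n^\alpha(\ell_\infty)=\Theta\Big(\frac{\log n}{\log(\frac{\alpha}{\log n}+1)}\Big)$.
   Context: Metric dimension reduction modulus: for $n\in\mathbb{N}$, $\alpha\in[1,\infty)$ and a (possibly infinite-dimensional) normed space $X$, $k_n^\alpha(X)$ denotes the minimum $k\in\mathbb{N}$ such that for every $n$-point subset $S\subset X$ there are a $k$-dimensional linear subspace $F_S$ of $X$ and a mapping $f:S\to F_S$ satisfying $$\|f(s)-f(s')\|_X\le \|s-s'\|_X\le \alpha\,\|f(s)-f(s')\|_X\quad\text{for all } s,s'\in S.$$ Here $\ell_\infty$ is the space of bounded real sequences with the supremum norm. Since every finite metric space and every finite-dimensional normed space can be embedded into $\ell_\infty$ in the relevant sense, the paper treats $k_n^\alpha(\ell_\infty)$ as the minimum $k$ such that every $n$-point metric space embeds with bi-Lipschitz distortion at most $\alpha$ into some $k$-dimensional normed space. *)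

theory Defs
  imports "HOL-Analysis.Analysis"
begin

(* nat carries the discrete topology, so every sequence is continuous and the bounded continuous
   functions nat => real are exactly the bounded real sequences; their norm is the supremum norm. *)
type_synonym linfty = "nat \<Rightarrow>\<^sub>C real"

(* The finite spanning set is needed because dim is 0 on infinite-dimensional subspaces. *)
definition fin_dim_subspace :: "'a::real_vector set \<Rightarrow> nat \<Rightarrow> bool" where
  "fin_dim_subspace F k \<longleftrightarrow>
     subspace F \<and> (\<exists>B. finite B \<and> span B = F) \<and> dim F = k"

definition reduces_to_dim :: "'a::real_normed_vector itself \<Rightarrow> nat \<Rightarrow> real \<Rightarrow> nat \<Rightarrow> bool" where
  "reduces_to_dim X n \<alpha> k \<longleftrightarrow>
     (\<forall>S::'a set. finite S \<and> card S = n \<longrightarrow>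
        (\<exists>(F::'a set) f. fin_dim_subspace F k \<and> f ` S \<subseteq> F \<and>
           (\<forall>s\<in>S. \<forall>s'\<in>S. norm (f s - f s') \<le> norm (s - s') \<and>
                             norm (s - s') \<le> \<alpha> * norm (f s - f s'))))"

(* The modulus k_n^alpha(X).  For 1 <= alpha the minimum is attained: if X has dimension at least n,
   then k = n qualifies (f the identity, F an n-dimensional subspace containing S); otherwise
   k = dim X qualifies (F = X). *)
definition dim_reduction_modulus :: "'a::real_normed_vector itself \<Rightarrow> nat \<Rightarrow> real \<Rightarrow> nat" where
  "dim_reduction_modulus X n \<alpha> = (LEAST k. reduces_to_dim X n \<alpha> k)"

end

theory Submission
  imports Defs "HOL-Real_Asymp.Real_Asymp"
begin

text \<open>
  Upper bound. A metric space with \<open>n\<close> points has, at every scale \<open>s\<close>, a partition into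
  clusters of diameter at most \<open>4 s\<close> in which a point \<open>x\<close> is at distance at least \<open>s / (2 N)\<close> from
  the other clusters with probability at least \<open>(|B(x, s)| / |B(x, 2 s)|) ^ (1 / N)\<close>. Over all dyadic
  scales these probabilities telescope, so a fraction \<open>n ^ (- 1 / N)\<close> of the points is padded at all
  scales simultaneously. On the padded points, independent random signs of the clusters, weighted
  by the scale, give a Lipschitz function; its minimal Lipschitz extension separates a padded point
  from any other point, up to a factor \<open>O(N)\<close>, with probability at least one half. Hence any set of
  pairs contains a fixed fraction of pairs that are separated by a single \<open>1\<close>-Lipschitz function
  with distortion \<open>O(N)\<close>, where \<open>N\<close> is a small multiple of \<open>ln n\<close>; choosing such functions greedily
  embeds the space into \<open>k\<close>-dimensional \<open>\<ell>\<^sub>\<infinity>\<close> with \<open>k = O(ln n)\<close>. For larger \<open>\<alpha>\<close>, generic combinations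
  of a few such functions separate all but a fraction of order \<open>1 / T\<close> of the pairs, at the cost of a
  factor \<open>O(T ln T)\<close> in the distortion, so fewer functions suffice.

  Lower bound. For a permutation \<open>p\<close> of \<open>{0, ..., n - 1}\<close> add the edges \<open>{x, p x}\<close> to the path on
  these vertices. Suppose all these graphs embed into \<open>k\<close>-dimensional normed spaces with distortion
  \<open>\<alpha>\<close>. Following the path, an embedding is encoded up to bounded error by \<open>O(k)\<close> bits per vertex,
  and the code determines a list of candidates for each \<open>p x\<close>, namely the vertices mapped within
  bounded distance from \<open>x\<close>. By volume and the bounded degree there are only
  \<open>O(1 + \<alpha> / ln n) ^ k * n ^ (1 / 4)\<close> of them. Comparing with the \<open>n!\<close> permutations bounds \<open>k\<close> from
  below.
\<close>

section \<open>Padded clusters at all scales\<close>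

lemma exists_ge_average:
  fixes f :: "'a \<Rightarrow> real"
  assumes "finite A" "A \<noteq> {}" "real (card A) * t \<le> sum f A"
  shows "\<exists>a\<in>A. t \<le> f a"
proof (rule ccontr)
  assume "\<not> ?thesis"
  then have "sum f A < (\<Sum>a\<in>A. t)"
    using assms by (intro sum_strict_mono) auto
  then show False using assms by simp
qed

text \<open>Each point goes to the first centre within distance \<^term>\<open>R\<close>, for an ordering of the centres
  that is built by repeatedly choosing the next centre at least as well as on average. A point is
  padded if the first centre within \<^term>\<open>R + \<tau>\<close> lies within \<^term>\<open>R - \<tau>\<close>.\<close>

lemma ball_assignment:
  fixes Z U :: "'a::metric_space set" and w :: "'a \<Rightarrow> real"
  assumes "finite Z" "finite U" "\<forall>x\<in>U. 0 \<le> w x" "0 \<le> \<tau>"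
  shows "\<exists>c. (\<forall>y. (\<exists>z\<in>Z. dist y z \<le> R) \<longrightarrow> c y \<in> Z \<and> dist y (c y) \<le> R) \<and>
      (\<Sum>x\<in>U. w x * (card (Z \<inter> cball x (R - \<tau>)) / card (Z \<inter> cball x (R + \<tau>))))
        \<le> sum w {x\<in>U. \<forall>y. dist x y \<le> \<tau> \<longrightarrow> c y = c x}"
  using assms
proof (induction "card Z" arbitrary: Z U)
  case 0
  then have "Z = {}" by simp
  then show ?case using 0 by (intro exI[of _ "\<lambda>x. x"]) (auto intro!: sum_nonneg)
next
  case (Suc m)
  define q where "q x = card (Z \<inter> cball x (R - \<tau>)) / card (Z \<inter> cball x (R + \<tau>))" for x
  \<comment> \<open>The gain from making \<open>z\<close> the first centre: points within
    \<open>R - \<tau>\<close> are padded at once, points beyond \<open>R + \<tau>\<close> keep the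
    share promised by induction, and those in between are lost.\<close>
  define W where "W z = sum w {x\<in>U. dist x z \<le> R - \<tau>} + (\<Sum>x\<in>{x\<in>U. dist x z > R + \<tau>}. w x * q x)" for z
  have "Z \<noteq> {}" using Suc by auto
  have W': "W z = (\<Sum>x\<in>U. w x * (of_bool (dist x z \<le> R - \<tau>) + of_bool (dist x z > R + \<tau>) * q x))" for z
  proof -
    have "sum w {x\<in>U. dist x z \<le> R - \<tau>} = (\<Sum>x\<in>U. w x * of_bool (dist x z \<le> R - \<tau>))"
      by (rule sum.mono_neutral_cong_left) (use Suc in auto)
    moreover have "(\<Sum>x\<in>{x\<in>U. dist x z > R + \<tau>}. w x * q x) = (\<Sum>x\<in>U. w x * (of_bool (dist x z > R + \<tau>) * q x))"
      by (rule sum.mono_neutral_cong_left) (use Suc in auto)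
    ultimately show ?thesis
      by (simp add: W_def distrib_left sum.distrib)
  qed
  \<comment> \<open>\<open>q x\<close> times the number of centres within \<open>R + \<tau>\<close>
    is the number within \<open>R - \<tau>\<close>, so the gains add up to exactly
    \<open>card Z * q x\<close>.\<close>
  have pt: "(\<Sum>z\<in>Z. of_bool (dist x z \<le> R - \<tau>) + of_bool (dist x z > R + \<tau>) * q x) = card Z * q x" for x
  proof -
    have 1: "(\<Sum>z\<in>Z. of_bool (dist x z \<le> R - \<tau>)) = real (card (Z \<inter> cball x (R - \<tau>)))"
      using \<open>finite Z\<close> by (simp add: Int_def cball_def sum.If_cases of_bool_def)
    have 2: "(\<Sum>z\<in>Z. of_bool (dist x z > R + \<tau>)) = real (card Z) - real (card (Z \<inter> cball x (R + \<tau>)))"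
    proof -
      have "(\<Sum>z\<in>Z. of_bool (dist x z > R + \<tau>)) = real (card (Z - Z \<inter> cball x (R + \<tau>)))"
        using \<open>finite Z\<close> by (simp add: Int_def cball_def sum.If_cases of_bool_def set_diff_eq not_le)
          (rule arg_cong[of _ _ card], auto)
      also have "\<dots> = real (card Z) - real (card (Z \<inter> cball x (R + \<tau>)))"
        using \<open>finite Z\<close> by (subst card_Diff_subset) (auto simp: of_nat_diff card_mono)
      finally show ?thesis .
    qed
    have 3: "card (Z \<inter> cball x (R - \<tau>)) = 0" if "card (Z \<inter> cball x (R + \<tau>)) = 0"
    proof -
      have "Z \<inter> cball x (R - \<tau>) \<subseteq> Z \<inter> cball x (R + \<tau>)" using \<open>0 \<le> \<tau>\<close> by auto
      then show ?thesis using that \<open>finite Z\<close> by (metis card_eq_0_iff finite_Int subset_empty)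
    qed
    show ?thesis
      unfolding sum.distrib 1 sum_distrib_right[symmetric] 2
      using 3 by (cases "card (Z \<inter> cball x (R + \<tau>)) = 0") (auto simp: q_def field_simps)
  qed
  have "sum W Z = (\<Sum>x\<in>U. w x * (\<Sum>z\<in>Z. of_bool (dist x z \<le> R - \<tau>) + of_bool (dist x z > R + \<tau>) * q x))"
    unfolding W' sum_distrib_left by (rule sum.swap)
  also have "\<dots> = card Z * (\<Sum>x\<in>U. w x * q x)"
    unfolding pt by (simp add: sum_distrib_left mult_ac)
  finally have "\<exists>z\<in>Z. (\<Sum>x\<in>U. w x * q x) \<le> W z"
    using \<open>finite Z\<close> \<open>Z \<noteq> {}\<close> by (intro exists_ge_average) auto
  then obtain z where z: "z \<in> Z" "(\<Sum>x\<in>U. w x * q x) \<le> W z" by blast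
  define Z' where "Z' = Z - {z}"
  define U' where "U' = {x\<in>U. dist x z > R + \<tau>}"
  have "\<exists>c. (\<forall>y. (\<exists>z\<in>Z'. dist y z \<le> R) \<longrightarrow> c y \<in> Z' \<and> dist y (c y) \<le> R) \<and>
      (\<Sum>x\<in>U'. w x * (card (Z' \<inter> cball x (R - \<tau>)) / card (Z' \<inter> cball x (R + \<tau>))))
        \<le> sum w {x\<in>U'. \<forall>y. dist x y \<le> \<tau> \<longrightarrow> c y = c x}"
    using Suc.hyps Suc.prems z by (intro Suc.hyps(1)) (auto simp: Z'_def U'_def)
  then obtain c where c: "\<And>y. (\<exists>z\<in>Z'. dist y z \<le> R) \<Longrightarrow> c y \<in> Z' \<and> dist y (c y) \<le> R"
     and c2: "(\<Sum>x\<in>U'. w x * (card (Z' \<inter> cball x (R - \<tau>)) / card (Z' \<inter> cball x (R + \<tau>))))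
        \<le> sum w {x\<in>U'. \<forall>y. dist x y \<le> \<tau> \<longrightarrow> c y = c x}" by blast
  \<comment> \<open>Deleting \<open>z\<close> changes no relevant ball around the remaining points,
    so the inductive bound keeps the old ratios.\<close>
  have "Z' \<inter> cball x (R - \<tau>) = Z \<inter> cball x (R - \<tau>)" "Z' \<inter> cball x (R + \<tau>) = Z \<inter> cball x (R + \<tau>)"
    if "x \<in> U'" for x
    using that \<open>0 \<le> \<tau>\<close> by (auto simp: Z'_def U'_def)
  then have c2': "(\<Sum>x\<in>U'. w x * q x) \<le> sum w {x\<in>U'. \<forall>y. dist x y \<le> \<tau> \<longrightarrow> c y = c x}"
    using c2 by (simp add: q_def)
  define e where "e y = (if dist y z \<le> R then z else c y)" for y
  show ?case
  proof (intro exI[of _ e] conjI allI impI)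
    fix y assume "\<exists>z\<in>Z. dist y z \<le> R"
    then show "e y \<in> Z" "dist y (e y) \<le> R"
      using c[of y] z(1) by (auto simp: e_def Z'_def)
  next
    define Y where "Y = {x\<in>U'. \<forall>y. dist x y \<le> \<tau> \<longrightarrow> c y = c x}"
    define A where "A = {x\<in>U. dist x z \<le> R - \<tau>}"
    have YU: "Y \<subseteq> U" unfolding Y_def U'_def by blast
    have "dist x z > R + \<tau>" if "x \<in> Y" for x using that unfolding Y_def U'_def by blast
    then have "A \<inter> Y = {}" using \<open>0 \<le> \<tau>\<close> by (fastforce simp: A_def)
    have "e y = z" if "x \<in> A" "dist x y \<le> \<tau>" for x y
      using that dist_triangle[of y z x] by (auto simp: A_def e_def dist_commute)
    then have 1: "A \<subseteq> {x\<in>U. \<forall>y. dist x y \<le> \<tau> \<longrightarrow> e y = e x}"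
      using \<open>0 \<le> \<tau>\<close> by (auto simp: A_def)
    have eY: "e y = c y" if "x \<in> Y" "dist x y \<le> \<tau>" for x y
    proof -
      have "dist x z > R + \<tau>" using that(1) unfolding Y_def U'_def by blast
      then show ?thesis using that(2) dist_triangle[of x z y] by (auto simp: e_def)
    qed
    have "e y = e x" if "x \<in> Y" "dist x y \<le> \<tau>" for x y
    proof -
      have "c y = c x" using that unfolding Y_def by blast
      moreover have "dist x x \<le> \<tau>" using \<open>0 \<le> \<tau>\<close> by simp
      ultimately show ?thesis using eY[of x y] eY[of x x] that by metis
    qed
    then have 2: "Y \<subseteq> {x\<in>U. \<forall>y. dist x y \<le> \<tau> \<longrightarrow> e y = e x}"
      using YU by blast
    have "(\<Sum>x\<in>U. w x * q x) \<le> sum w A + sum w Y"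
      using z(2) c2' unfolding W_def A_def Y_def U'_def[symmetric] by linarith
    also have "\<dots> = sum w (A \<union> Y)"
      using \<open>A \<inter> Y = {}\<close> \<open>finite U\<close> YU by (subst sum.union_disjoint) (auto simp: A_def intro: finite_subset)
    also have "\<dots> \<le> sum w {x\<in>U. \<forall>y. dist x y \<le> \<tau> \<longrightarrow> e y = e x}"
      using 1 2 Suc.prems by (intro sum_mono2) auto
    finally show "(\<Sum>x\<in>U. w x * (card (Z \<inter> cball x (R - \<tau>)) / card (Z \<inter> cball x (R + \<tau>))))
        \<le> sum w {x\<in>U. \<forall>y. dist x y \<le> \<tau> \<longrightarrow> e y = e x}"
      by (simp add: q_def)
  qed
qed

text \<open>Averages over \<^term>\<open>N\<close> radii whose critical annuli tile the shell between the balls of radius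
  \<^term>\<open>s\<close> and \<^term>\<open>2 * s\<close>; the product of the ratios telescopes, hence AM-GM.\<close>

lemma scale_assignment:
  fixes X U :: "'a::metric_space set" and w :: "'a \<Rightarrow> real" and s :: real
  assumes "finite X" "U \<subseteq> X" "\<forall>x\<in>U. 0 \<le> w x" "0 \<le> s" "N \<ge> 1"
  shows "\<exists>c. (\<forall>y\<in>X. dist y (c y) \<le> 2 * s) \<and>
      (\<Sum>x\<in>U. w x * (card (X \<inter> cball x s) / card (X \<inter> cball x (2 * s))) powr (1 / real N))
        \<le> sum w {x\<in>U. \<forall>y. dist x y \<le> s / (2 * real N) \<longrightarrow> c y = c x}"
proof -
  define \<tau> where "\<tau> = s / (2 * real N)"
  have \<tau>: "0 \<le> \<tau>" "s + 2 * real N * \<tau> = 2 * s" using assms by (auto simp: \<tau>_def)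
  define v where "v x i = real (card (X \<inter> cball x (s + 2 * real i * \<tau>)))" for x i
  define R where "R i = s + (2 * real i + 1) * \<tau>" for i
  have fin: "finite U" using assms finite_subset by blast
  have Rv: "real (card (X \<inter> cball x (R i - \<tau>))) = v x i" "real (card (X \<inter> cball x (R i + \<tau>))) = v x (Suc i)" for x i
    by (simp_all add: R_def v_def algebra_simps)
  have am: "real N * (v x 0 / v x N) powr (1 / real N) \<le> (\<Sum>i<N. v x i / v x (Suc i))" if "x \<in> U" for x
  proof -
    have pos: "v x i \<noteq> 0" for i
      using that assms \<tau> by (auto simp: v_def)
    have "(\<Prod>i<N. v x i / v x (Suc i)) = v x 0 / v x N"
      by (rule prod_lessThan_telescope') (use pos in auto)
    moreover have "(\<Prod>i<N. v x i / v x (Suc i)) powr (1 / card {..<N}) \<le> (\<Sum>i<N. v x i / v x (Suc i) / card {..<N})"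
      using assms by (intro arith_geom_mean) (auto simp: v_def lessThan_empty_iff)
    ultimately have "(v x 0 / v x N) powr (1 / real N) \<le> (\<Sum>i<N. v x i / v x (Suc i)) / N"
      by (simp add: sum_divide_distrib)
    then show ?thesis using assms
      by (simp add: field_simps)
  qed
  have "N * (\<Sum>x\<in>U. w x * (v x 0 / v x N) powr (1 / real N)) = (\<Sum>x\<in>U. w x * (real N * (v x 0 / v x N) powr (1 / real N)))"
    by (simp add: sum_distrib_left mult_ac)
  also have "\<dots> \<le> (\<Sum>x\<in>U. w x * (\<Sum>i<N. v x i / v x (Suc i)))"
    using am assms by (intro sum_mono mult_left_mono) auto
  also have "\<dots> = (\<Sum>i<N. \<Sum>x\<in>U. w x * (v x i / v x (Suc i)))"
    unfolding sum_distrib_left by (rule sum.swap)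
  finally have "\<exists>i\<in>{..<N}. (\<Sum>x\<in>U. w x * (v x 0 / v x N) powr (1 / real N)) \<le> (\<Sum>x\<in>U. w x * (v x i / v x (Suc i)))"
    using assms by (intro exists_ge_average) (auto simp: lessThan_empty_iff)
  then obtain i where i: "i < N" "(\<Sum>x\<in>U. w x * (v x 0 / v x N) powr (1 / real N)) \<le> (\<Sum>x\<in>U. w x * (v x i / v x (Suc i)))"
    by blast
  obtain c where c: "\<And>y. (\<exists>z\<in>X. dist y z \<le> R i) \<Longrightarrow> c y \<in> X \<and> dist y (c y) \<le> R i"
    and c2: "(\<Sum>x\<in>U. w x * (v x i / v x (Suc i))) \<le> sum w {x\<in>U. \<forall>y. dist x y \<le> \<tau> \<longrightarrow> c y = c x}"
    using ball_assignment[OF assms(1) fin assms(3) \<tau>(1), of "R i"] unfolding Rv by blast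
  have "(2 * real i + 1) * \<tau> \<le> 2 * real N * \<tau>"
    using i \<tau> by (intro mult_right_mono) auto
  then have R: "0 \<le> R i" "R i \<le> 2 * s" using \<tau> assms(4) by (auto simp: R_def)
  have "\<forall>y\<in>X. dist y (c y) \<le> 2 * s"
  proof
    fix y assume "y \<in> X"
    then have "\<exists>z\<in>X. dist y z \<le> R i" using R by (intro bexI[of _ y]) auto
    then show "dist y (c y) \<le> 2 * s" using c[of y] R by auto
  qed
  moreover have "v x 0 = card (X \<inter> cball x s)" "v x N = card (X \<inter> cball x (2 * s))" for x
    using \<tau> by (auto simp: v_def)
  ultimately show ?thesis using i(2) c2 unfolding \<tau>_def by (intro exI[of _ c]) auto
qed

text \<open>Scales are added one by one. Padding at scale \<open>J\<close> is sought only among the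
  survivors of the finer scales, so the induction is applied to weights \<open>w'\<close> that
  already contain the loss at scale \<open>J\<close>. The losses telescope to a single ratio of
  balls.\<close>

lemma multiscale_assignment:
  fixes X :: "'a::metric_space set" and w :: "'a \<Rightarrow> real" and s :: real
  assumes "finite X" "\<forall>x\<in>X. 0 \<le> w x" "0 \<le> s" "N \<ge> 1"
  shows "\<exists>c. (\<forall>j<J. \<forall>y\<in>X. dist y (c j y) \<le> 2 * (s * 2 ^ j)) \<and>
      (\<Sum>x\<in>X. w x * (card (X \<inter> cball x s) / card (X \<inter> cball x (s * 2 ^ J))) powr (1 / real N))
        \<le> sum w {x\<in>X. \<forall>j<J. \<forall>y. dist x y \<le> s * 2 ^ j / (2 * real N) \<longrightarrow> c j y = c j x}"
  using assms(2)
proof (induction J arbitrary: w)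
  case 0
  have "card (X \<inter> cball x s) \<noteq> 0" if "x \<in> X" for x
    using that assms by (auto simp: card_eq_0_iff)
  then have "real (card (X \<inter> cball x s)) \<noteq> 0" if "x \<in> X" for x
    using that by simp
  then have eq: "(\<Sum>x\<in>X. w x * (card (X \<inter> cball x s) / card (X \<inter> cball x (s * 2 ^ 0))) powr (1 / real N)) = sum w X"
    by (intro sum.cong) (simp_all del: of_nat_eq_0_iff)
  show ?case unfolding eq by (intro exI[of _ "\<lambda>_ x. x"]) simp
next
  case (Suc J)
  define V where "V x j = real (card (X \<inter> cball x (s * 2 ^ j)))" for x j
  have V: "V x j > 0" if "x \<in> X" for x j
    using that assms by (auto simp: V_def card_gt_0_iff)
  have V0: "real (card (X \<inter> cball x s)) = V x 0" for x by (simp add: V_def)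
  define w' where "w' x = w x * (V x J / V x (Suc J)) powr (1 / real N)" for x
  have w': "\<forall>x\<in>X. 0 \<le> w' x" using Suc.prems unfolding w'_def by simp
  obtain c where c: "(\<forall>j<J. \<forall>y\<in>X. dist y (c j y) \<le> 2 * (s * 2 ^ j)) \<and>
    (\<Sum>x\<in>X. w' x * (card (X \<inter> cball x s) / card (X \<inter> cball x (s * 2 ^ J))) powr (1 / real N))
        \<le> sum w' {x\<in>X. \<forall>j<J. \<forall>y. dist x y \<le> s * 2 ^ j / (2 * real N) \<longrightarrow> c j y = c j x}"
    using Suc.IH[OF w'] ..
  define U where "U = {x\<in>X. \<forall>j<J. \<forall>y. dist x y \<le> s * 2 ^ j / (2 * real N) \<longrightarrow> c j y = c j x}"
  have "U \<subseteq> X" by (auto simp: U_def)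
  obtain d where d: "(\<forall>y\<in>X. dist y (d y) \<le> s * 2 ^ Suc J) \<and>
    (\<Sum>x\<in>U. w x * (V x J / V x (Suc J)) powr (1 / real N))
        \<le> sum w {x\<in>U. \<forall>y. dist x y \<le> (s * 2 ^ J) / (2 * real N) \<longrightarrow> d y = d x}"
  proof -
    have 1: "2 * (s * 2 ^ J) = s * 2 ^ Suc J" by simp
    have 2: "0 \<le> s * 2 ^ J" using assms(3) by simp
    have 3: "\<forall>x\<in>U. 0 \<le> w x" using \<open>U \<subseteq> X\<close> Suc.prems by blast
    show thesis
      using scale_assignment[OF assms(1) \<open>U \<subseteq> X\<close> 3 2 assms(4)] that unfolding V_def 1 by (elim exE)
  qed
  have "(\<Sum>x\<in>X. w x * (V x 0 / V x (Suc J)) powr (1 / real N)) = (\<Sum>x\<in>X. w' x * (V x 0 / V x J) powr (1 / real N))"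
  proof (rule sum.cong)
    fix x assume "x \<in> X"
    then show "w x * (V x 0 / V x (Suc J)) powr (1 / real N) = w' x * (V x 0 / V x J) powr (1 / real N)"
      using V[of x 0] V[of x J] V[of x "Suc J"]
      by (simp add: w'_def powr_divide)
  qed simp
  also have "\<dots> \<le> sum w' U" using conjunct2[OF c] unfolding U_def V_def by simp
  also have "\<dots> \<le> sum w {x\<in>U. \<forall>y. dist x y \<le> (s * 2 ^ J) / (2 * real N) \<longrightarrow> d y = d x}"
    using conjunct2[OF d] by (simp add: w'_def)
  also have "{x\<in>U. \<forall>y. dist x y \<le> (s * 2 ^ J) / (2 * real N) \<longrightarrow> d y = d x} =
     {x\<in>X. \<forall>j<Suc J. \<forall>y. dist x y \<le> s * 2 ^ j / (2 * real N) \<longrightarrow> (c(J := d)) j y = (c(J := d)) j x}"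
    by (auto simp: U_def less_Suc_eq)
  finally show ?case
    using conjunct1[OF c] conjunct1[OF d] unfolding V0 V_def[symmetric]
    by (intro exI[of _ "c(J := d)"]) (auto simp: less_Suc_eq)
qed

section \<open>Separating functions from random signs\<close>

text \<open>Here \<open>t\<close> is the padding radius of the finest scale. The diameter of the
  clusters enters only in \<open>exists_separating_function\<close>.\<close>

locale assignment_hierarchy =
  fixes X :: "'a::metric_space set" and J :: nat and c :: "nat \<Rightarrow> 'a \<Rightarrow> 'a" and t :: real
  assumes finite_X: "finite X" and t_pos: "0 < t"
begin

definition padded :: "'a set" where
  "padded = {x\<in>X. \<forall>j<J. \<forall>y\<in>X. dist x y \<le> t * 2 ^ j \<longrightarrow> c j y = c j x}"

text \<open>The partitions at different scales need not be nested, so a cluster is refined by all coarser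
  scales.\<close>

definition cluster :: "nat \<Rightarrow> 'a \<Rightarrow> 'a set" where
  "cluster j x = {y\<in>X. \<forall>i. j \<le> i \<and> i < J \<longrightarrow> c i y = c i x}"

text \<open>The coarsest scale that separates the two points; of interest only if some scale
  does.\<close>

definition level :: "'a \<Rightarrow> 'a \<Rightarrow> nat" where
  "level x y = Max {j. j < J \<and> c j x \<noteq> c j y}"

text \<open>A set \<open>\<sigma>\<close> of scale-cluster pairs encodes a choice of signs, so that
  random signs become counting in a power set.\<close>

definition sign :: "(nat \<times> 'a set) set \<Rightarrow> nat \<Rightarrow> 'a \<Rightarrow> real" where
  "sign \<sigma> j x = (if (j, cluster j x) \<in> \<sigma> then 1 else - 1)"

definition height :: "(nat \<times> 'a set) set \<Rightarrow> 'a \<Rightarrow> real" where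
  "height \<sigma> x = (\<Sum>j<J. sign \<sigma> j x * (t * 2 ^ j))"

text \<open>McShane's formula for a 4-Lipschitz extension of \<open>height\<close> from the padded
  points.\<close>

definition extension :: "(nat \<times> 'a set) set \<Rightarrow> 'a \<Rightarrow> real" where
  "extension \<sigma> y = Min ((\<lambda>w. height \<sigma> w + 4 * dist y w) ` padded)"

text \<open>Reverses the sign of a single cluster: that of \<open>x\<close> at the coarsest scale
  separating it from \<open>y\<close>.\<close>

definition flip :: "'a \<Rightarrow> 'a \<Rightarrow> (nat \<times> 'a set) set \<Rightarrow> (nat \<times> 'a set) set" where
  "flip x y \<sigma> = (let p = (level x y, cluster (level x y) x) in if p \<in> \<sigma> then \<sigma> - {p} else insert p \<sigma>)"

lemma padded_subset: "padded \<subseteq> X" and finite_padded: "finite padded"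
  using finite_X by (auto simp: padded_def)

lemma paddedD: "x \<in> padded \<Longrightarrow> j < J \<Longrightarrow> y \<in> X \<Longrightarrow> c j y \<noteq> c j x \<Longrightarrow> t * 2 ^ j < dist x y"
  unfolding padded_def by force

lemma cluster_cong: "(\<And>i. j \<le> i \<Longrightarrow> i < J \<Longrightarrow> c i x = c i y) \<Longrightarrow> cluster j x = cluster j y"
  unfolding cluster_def by auto

lemma cluster_eqD:
  assumes "x \<in> X" "cluster j x = cluster j y" "j \<le> i" "i < J"
  shows "c i x = c i y"
proof -
  have "x \<in> cluster j y" using assms(1) unfolding assms(2)[symmetric] by (simp add: cluster_def)
  then show ?thesis using assms(3,4) unfolding cluster_def by blast
qed

lemma level:
  assumes "\<exists>j<J. c j x \<noteq> c j y"
  shows "level x y < J" "c (level x y) x \<noteq> c (level x y) y"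
    "\<And>i. level x y < i \<Longrightarrow> i < J \<Longrightarrow> c i x = c i y"
proof -
  have fin: "finite {j. j < J \<and> c j x \<noteq> c j y}" by simp
  have "level x y \<in> {j. j < J \<and> c j x \<noteq> c j y}"
    unfolding level_def using assms by (intro Max_in) auto
  then show "level x y < J" "c (level x y) x \<noteq> c (level x y) y" by auto
  show "c i x = c i y" if "level x y < i" "i < J" for i
  proof (rule ccontr)
    assume "c i x \<noteq> c i y"
    then have "i \<le> level x y" using that(2) unfolding level_def by (intro Max_ge fin) simp
    then show False using that(1) by simp
  qed
qed

text \<open>Signs agree from scale \<open>k\<close> on, and the finer scales contribute a geometric
  sum. The \<open>- 1\<close> makes the heights equal for points that no scale separates
  (\<open>k = 0\<close>).\<close>

lemma height_diff:
  assumes "\<And>i. k \<le> i \<Longrightarrow> i < J \<Longrightarrow> c i x = c i y" "k \<le> J"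
  shows "\<bar>height \<sigma> x - height \<sigma> y\<bar> \<le> 2 * t * (2 ^ k - 1)"
proof -
  have eq: "sign \<sigma> j x = sign \<sigma> j y" if "k \<le> j" for j
    unfolding sign_def by (subst cluster_cong[of j x y]) (use assms that in auto)
  have "height \<sigma> x - height \<sigma> y = (\<Sum>j<J. (sign \<sigma> j x - sign \<sigma> j y) * (t * 2 ^ j))"
    by (simp add: height_def sum_subtractf left_diff_distrib)
  also have "\<dots> = (\<Sum>j<k. (sign \<sigma> j x - sign \<sigma> j y) * (t * 2 ^ j))"
    using eq assms(2) by (intro sum.mono_neutral_right) (auto simp: not_less)
  also have "\<bar>\<dots>\<bar> \<le> (\<Sum>j<k. \<bar>(sign \<sigma> j x - sign \<sigma> j y) * (t * 2 ^ j)\<bar>)"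
    by (rule sum_abs)
  also have "\<dots> \<le> (\<Sum>j<k. 2 * t * 2 ^ j)"
    using t_pos by (intro sum_mono) (auto simp: sign_def abs_mult)
  also have "\<dots> = 2 * t * (2 ^ k - 1)"
    by (simp add: sum_distrib_left[symmetric] geometric_sum)
  finally show ?thesis .
qed

text \<open>At the coarsest separating scale \<open>l\<close>, padding of \<open>x\<close> forces a
  distance above \<open>t * 2 ^ l\<close>, and the scales up to \<open>l\<close> change the height
  by less than four times that.\<close>

lemma height_lipschitz:
  assumes "x \<in> padded" "y \<in> X"
  shows "\<bar>height \<sigma> x - height \<sigma> y\<bar> \<le> 4 * dist x y"
proof (cases "\<exists>j<J. c j x \<noteq> c j y")
  case False
  then show ?thesis using height_diff[of 0 x y \<sigma>] by (auto intro: order_trans)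
next
  case True
  note l = level[OF True]
  have "\<bar>height \<sigma> x - height \<sigma> y\<bar> \<le> 2 * t * (2 ^ Suc (level x y) - 1)"
    using l by (intro height_diff) auto
  also have "\<dots> \<le> 4 * (t * 2 ^ level x y)" using t_pos by (simp add: algebra_simps)
  also have "\<dots> \<le> 4 * dist x y" using paddedD[OF assms(1) l(1) assms(2)] l(2) by auto
  finally show ?thesis .
qed

lemma extension_le: "w \<in> padded \<Longrightarrow> extension \<sigma> y \<le> height \<sigma> w + 4 * dist y w"
  unfolding extension_def using finite_padded by (intro Min_le) auto

lemma extension_attained:
  assumes "padded \<noteq> {}"
  shows "\<exists>w\<in>padded. extension \<sigma> y = height \<sigma> w + 4 * dist y w"
proof -
  have "extension \<sigma> y \<in> (\<lambda>w. height \<sigma> w + 4 * dist y w) ` padded"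
    unfolding extension_def using finite_padded assms by (intro Min_in) auto
  then show ?thesis by auto
qed

lemma extension_eq:
  assumes "x \<in> padded"
  shows "extension \<sigma> x = height \<sigma> x"
proof (rule antisym)
  show "extension \<sigma> x \<le> height \<sigma> x" using extension_le[OF assms, of \<sigma> x] by simp
  obtain w where "w \<in> padded" "extension \<sigma> x = height \<sigma> w + 4 * dist x w"
    using extension_attained assms by blast
  then show "height \<sigma> x \<le> extension \<sigma> x"
    using height_lipschitz[OF assms, of w \<sigma>] padded_subset by auto
qed

lemma extension_lipschitz:
  assumes "padded \<noteq> {}"
  shows "\<bar>extension \<sigma> x - extension \<sigma> y\<bar> \<le> 4 * dist x y"
proof -
  have "extension \<sigma> x \<le> extension \<sigma> y + 4 * dist x y" for x y
  proof -
    obtain w where "w \<in> padded" "extension \<sigma> y = height \<sigma> w + 4 * dist y w"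
      using extension_attained assms by blast
    then show ?thesis using extension_le[of w \<sigma> x] dist_triangle[of x w y] by auto
  qed
  from this[of x y] this[of y x] show ?thesis by (simp add: dist_commute abs_le_iff)
qed

lemma flip_flip: "flip x y (flip x y \<sigma>) = \<sigma>"
  by (auto simp: flip_def Let_def)

lemma sign_flip:
  "sign (flip x y \<sigma>) j w =
     (if j = level x y \<and> cluster j w = cluster j x then - sign \<sigma> j w else sign \<sigma> j w)"
proof -
  define p where "p = (level x y, cluster (level x y) x)"
  define q where "q = (j, cluster j w)"
  have q: "q = p \<longleftrightarrow> j = level x y \<and> cluster j w = cluster j x"
    unfolding p_def q_def by blast
  have "flip x y \<sigma> = (if p \<in> \<sigma> then \<sigma> - {p} else insert p \<sigma>)"
    unfolding flip_def p_def Let_def ..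
  then have "q \<in> flip x y \<sigma> \<longleftrightarrow> (if q = p then q \<notin> \<sigma> else q \<in> \<sigma>)" by simp
  then show ?thesis unfolding sign_def q[symmetric] q_def[symmetric] by simp
qed

lemma height_flip_other:
  assumes "cluster (level x y) w \<noteq> cluster (level x y) x"
  shows "height (flip x y \<sigma>) w = height \<sigma> w"
  unfolding height_def sign_flip by (intro sum.cong) (use assms in auto)

lemma height_flip_self:
  assumes "\<exists>j<J. c j x \<noteq> c j y"
  shows "\<bar>height (flip x y \<sigma>) x - height \<sigma> x\<bar> = 2 * (t * 2 ^ level x y)"
proof -
  have "height (flip x y \<sigma>) x - height \<sigma> x = (\<Sum>j<J. (sign (flip x y \<sigma>) j x - sign \<sigma> j x) * (t * 2 ^ j))"
    by (simp add: height_def sum_subtractf left_diff_distrib)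
  also have "\<dots> = (\<Sum>j\<in>{level x y}. (sign (flip x y \<sigma>) j x - sign \<sigma> j x) * (t * 2 ^ j))"
    using level(1)[OF assms] by (intro sum.mono_neutral_right) (auto simp: sign_flip)
  also have "\<bar>\<dots>\<bar> = 2 * (t * 2 ^ level x y)"
    using t_pos by (simp add: sign_flip) (simp add: sign_def abs_mult)
  finally show ?thesis .
qed

definition separates :: "(nat \<times> 'a set) set \<Rightarrow> 'a \<Rightarrow> 'a \<Rightarrow> bool" where
  "separates \<sigma> x y \<longleftrightarrow> t * 2 ^ level x y \<le> \<bar>extension \<sigma> x - extension \<sigma> y\<bar>"

text \<open>If \<^term>\<open>y\<close> is not yet separated from \<^term>\<open>x\<close>, then the minimum defining the extension at
  \<^term>\<open>y\<close> is attained outside the cluster whose sign is flipped: points of that cluster are far from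
  \<^term>\<open>y\<close> and nearly as high as \<^term>\<open>x\<close>.\<close>

lemma extension_flip_le:
  assumes "x \<in> padded" "y \<in> X" "\<exists>j<J. c j x \<noteq> c j y" "\<not> separates \<sigma> x y"
  shows "extension (flip x y \<sigma>) y \<le> extension \<sigma> y"
proof -
  note l = level[OF assms(3)]
  obtain w where w: "w \<in> padded" "extension \<sigma> y = height \<sigma> w + 4 * dist y w"
    using extension_attained assms(1) by blast
  have "cluster (level x y) w \<noteq> cluster (level x y) x"
  proof
    assume eq: "cluster (level x y) w = cluster (level x y) x"
    have c: "c i w = c i x" if "level x y \<le> i" "i < J" for i
      using cluster_eqD[OF _ eq that] w padded_subset by blast
    have "\<bar>height \<sigma> w - height \<sigma> x\<bar> \<le> 2 * t * (2 ^ level x y - 1)"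
      using c l by (intro height_diff) auto
    moreover have "t * 2 ^ level x y < dist w y"
      using paddedD[OF w(1) l(1) assms(2)] l(2) c[OF order_refl l(1)] by simp
    ultimately have "t * 2 ^ level x y \<le> extension \<sigma> y - extension \<sigma> x"
      using t_pos w(2) extension_eq[OF assms(1), of \<sigma>] by (simp add: algebra_simps dist_commute)
    then show False using assms(4) by (simp add: separates_def)
  qed
  then show ?thesis
    using extension_le[OF w(1), of "flip x y \<sigma>" y] w(2) by (simp add: height_flip_other)
qed

text \<open>If both sign choices failed, \<open>extension_flip_le\<close> in both directions would
  fix the extension at \<open>y\<close>, although the flip moves its value at \<open>x\<close> by
  twice the threshold in \<open>separates\<close>.\<close>

lemma separates_or_flip:
  assumes "x \<in> padded" "y \<in> X" "\<exists>j<J. c j x \<noteq> c j y"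
  shows "separates \<sigma> x y \<or> separates (flip x y \<sigma>) x y"
proof (rule ccontr)
  assume *: "\<not> ?thesis"
  then have "extension (flip x y \<sigma>) y = extension \<sigma> y"
    using extension_flip_le[OF assms, of \<sigma>] extension_flip_le[OF assms, of "flip x y \<sigma>"]
    by (simp add: flip_flip)
  then show False
    using * height_flip_self[OF assms(3), of \<sigma>]
      extension_eq[OF assms(1), of \<sigma>] extension_eq[OF assms(1), of "flip x y \<sigma>"]
    unfolding separates_def by linarith
qed

text \<open>The flip injects the sign choices that fail for a pair into those that separate it, so
  at least half of all choices separate it; then average over the choices.\<close>

lemma exists_separating_signs:
  assumes E: "finite E" "\<And>x y. (x, y) \<in> E \<Longrightarrow> x \<in> padded \<and> y \<in> X \<and> (\<exists>j<J. c j x \<noteq> c j y)"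
  shows "\<exists>\<sigma>. real (card E) / 2 \<le> card {(x, y) \<in> E. separates \<sigma> x y}"
proof -
  define \<Omega> where "\<Omega> = Pow ({..<J} \<times> Pow X)"
  have fin: "finite \<Omega>" "\<Omega> \<noteq> {}" unfolding \<Omega>_def using finite_X by (simp_all add: Pow_not_empty)
  have half: "card \<Omega> / 2 \<le> (\<Sum>\<sigma>\<in>\<Omega>. of_bool (separates \<sigma> x y) :: real)" if "(x, y) \<in> E" for x y
  proof -
    have xy: "x \<in> padded" "y \<in> X" "\<exists>j<J. c j x \<noteq> c j y" using E(2)[OF that] by auto
    define G where "G = {\<sigma>\<in>\<Omega>. separates \<sigma> x y}"
    have "cluster (level x y) x \<subseteq> X" by (auto simp: cluster_def)
    then have "flip x y \<sigma> \<in> \<Omega>" if "\<sigma> \<in> \<Omega>" for \<sigma>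
      using that level(1)[OF xy(3)] by (auto simp: \<Omega>_def flip_def Let_def)
    then have "flip x y ` (\<Omega> - G) \<subseteq> G"
      using separates_or_flip[OF xy] by (auto simp: G_def)
    moreover have "inj (flip x y)" by (metis flip_flip injI)
    ultimately have "card (\<Omega> - G) \<le> card G"
      using fin by (intro card_inj_on_le[of "flip x y"]) (auto simp: G_def inj_on_def)
    moreover have "card (\<Omega> - G) = card \<Omega> - card G" "card G \<le> card \<Omega>"
      using fin by (auto simp: G_def card_Diff_subset card_mono)
    moreover have "(\<Sum>\<sigma>\<in>\<Omega>. of_bool (separates \<sigma> x y) :: real) = card G"
      using fin by (simp add: G_def of_bool_def sum.If_cases Int_def)
    ultimately show ?thesis by auto
  qed
  have "card \<Omega> * (card E / 2) = (\<Sum>(x, y)\<in>E. card \<Omega> / 2)" by (simp add: case_prod_unfold)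
  also have "\<dots> \<le> (\<Sum>(x, y)\<in>E. \<Sum>\<sigma>\<in>\<Omega>. of_bool (separates \<sigma> x y))"
    using half by (intro sum_mono) auto
  also have "\<dots> = (\<Sum>\<sigma>\<in>\<Omega>. \<Sum>(x, y)\<in>E. of_bool (separates \<sigma> x y))"
    unfolding case_prod_unfold by (rule sum.swap)
  also have "\<dots> = (\<Sum>\<sigma>\<in>\<Omega>. real (card {(x, y) \<in> E. separates \<sigma> x y}))"
    using E(1) by (simp add: of_bool_def sum.If_cases Int_def case_prod_unfold)
  finally show ?thesis
    using exists_ge_average[OF fin, of "real (card E) / 2"] by auto
qed

end

lemma exists_separating_function:
  fixes X :: "'a::metric_space set" and N :: nat
  assumes "finite X" "E \<subseteq> X \<times> X" "\<And>x. (x, x) \<notin> E" "N \<ge> 1"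
  shows "\<exists>g::'a \<Rightarrow> real. (\<forall>x y. \<bar>g x - g y\<bar> \<le> dist x y) \<and>
    card X powr (- 1 / N) / 2 * card E \<le> card {(x, y) \<in> E. dist x y \<le> 64 * real N * \<bar>g x - g y\<bar>}"
proof (cases "E = {}")
  case True
  then show ?thesis by (intro exI[of _ "\<lambda>_. 0"]) auto
next
  case False
  have finE: "finite E" using assms finite_subset by blast
  define D where "D = (\<lambda>(x, y). dist x y) ` E"
  have D: "finite D" "D \<noteq> {}" "\<And>d. d \<in> D \<Longrightarrow> 0 < d" using finE False assms(3) by (auto simp: D_def)
  \<comment> \<open>Clusters at scale 0 have diameter at most \<open>4 * s\<close>, less than the
    distance of any pair in \<open>E\<close>, so each pair is separated there.\<close>
  define s where "s = Min D / 5"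
  have s: "0 < s" using D by (simp add: s_def)
  \<comment> \<open>The scales exceed the largest distance, so that
    \<open>dist x y \<le> 8 * (s * 2 ^ level x y)\<close> holds even if the level is the last
    one.\<close>
  obtain J where J: "Max D / (4 * s) < 2 ^ J"
    using real_arch_pow[of 2] by auto
  \<comment> \<open>Weighting a point by the pairs that start at it turns weights of point sets into
    numbers of pairs.\<close>
  define w where "w x = real (card {y. (x, y) \<in> E})" for x
  have w0: "\<forall>x\<in>X. 0 \<le> w x" by (simp add: w_def)
  define t where "t = s / (2 * real N)"
  have t: "0 < t" using s assms(4) by (simp add: t_def)
  obtain c where c: "(\<forall>j<J. \<forall>y\<in>X. dist y (c j y) \<le> 2 * (s * 2 ^ j)) \<and>
      (\<Sum>x\<in>X. w x * (card (X \<inter> cball x s) / card (X \<inter> cball x (s * 2 ^ J))) powr (1 / real N))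
        \<le> sum w {x\<in>X. \<forall>j<J. \<forall>y. dist x y \<le> s * 2 ^ j / (2 * real N) \<longrightarrow> c j y = c j x}"
    using multiscale_assignment[OF assms(1) w0 less_imp_le[OF s] assms(4)] ..
  interpret assignment_hierarchy X J c t by unfold_locales (use assms t in auto)
  have c1: "dist y (c j y) \<le> 2 * (s * 2 ^ j)" if "j < J" "y \<in> X" for j y using c that by blast
  have near: "dist x y \<le> 4 * (s * 2 ^ j)" if "j < J" "x \<in> X" "y \<in> X" "c j x = c j y" for j x y
    using c1[OF that(1,2)] c1[OF that(1,3)] that(4) dist_triangle2[of x y "c j x"] by simp
  \<comment> \<open>One scale above its level the pair shares a cluster, which bounds its distance
    from above.\<close>
  have lev: "(\<exists>j<J. c j x \<noteq> c j y) \<and> dist x y \<le> 8 * (s * 2 ^ level x y)" if "(x, y) \<in> E" for x y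
  proof -
    have xy: "x \<in> X" "y \<in> X" using that assms(2) by auto
    have "dist x y \<in> D" using that by (force simp: D_def)
    then have d: "5 * s \<le> dist x y" "dist x y \<le> Max D" using D by (auto simp: s_def)
    have J2: "dist x y < 4 * (s * 2 ^ J)" using J d s by (simp add: field_simps)
    have "J \<noteq> 0"
      using J2 d s by (cases J) auto
    then have ex: "\<exists>j<J. c j x \<noteq> c j y"
      using near[of 0 x y] xy d s by (intro exI[of _ 0]) auto
    show ?thesis
    proof (cases "Suc (level x y) < J")
      case True
      then show ?thesis
        using near[OF True xy] level(3)[OF ex, of "Suc (level x y)"] ex by auto
    next
      case False
      then have "J = Suc (level x y)" using level(1)[OF ex] by auto
      then have "(2::real) ^ J = 2 ^ Suc (level x y)" by (rule arg_cong)
      then have "4 * (s * 2 ^ J) = 8 * (s * 2 ^ level x y)" unfolding power_Suc by simp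
      then have "dist x y \<le> 8 * (s * 2 ^ level x y)" using J2 by linarith
      then show ?thesis using ex by (intro conjI)
    qed
  qed
  define P where "P = {x\<in>X. \<forall>j<J. \<forall>y. dist x y \<le> s * 2 ^ j / (2 * real N) \<longrightarrow> c j y = c j x}"
  have "s * 2 ^ j / (2 * real N) = t * 2 ^ j" for j by (simp add: t_def)
  then have P: "P \<subseteq> padded" unfolding P_def padded_def by auto
  define E' where "E' = {(x, y) \<in> E. x \<in> padded}"
  have "finite E'" using finE by (auto simp: E'_def intro: finite_subset[of _ E])
  have fy: "finite {y. (x, y) \<in> E}" for x
    by (rule finite_subset[of _ "snd ` E"]) (use finE in force)+
  have sumw: "sum w A = card {(x, y) \<in> E. x \<in> A}" if "A \<subseteq> X" for A
  proof -
    have "finite A" using that assms(1) finite_subset by blast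
    have "card (SIGMA x:A. {y. (x, y) \<in> E}) = (\<Sum>x\<in>A. card {y. (x, y) \<in> E})"
      using \<open>finite A\<close> fy by (intro card_SigmaI) auto
    moreover have "(SIGMA x:A. {y. (x, y) \<in> E}) = {(x, y) \<in> E. x \<in> A}" by auto
    ultimately show ?thesis by (simp add: w_def)
  qed
  have "card X powr (- 1 / N) * card E = (\<Sum>x\<in>X. w x * card X powr (- 1 / N))"
  proof -
    have "{(x, y) \<in> E. x \<in> X} = E" using assms(2) by auto
    then show ?thesis using sumw[of X] by (simp add: sum_distrib_right[symmetric])
  qed
  also have "\<dots> \<le> (\<Sum>x\<in>X. w x * (card (X \<inter> cball x s) / card (X \<inter> cball x (s * 2 ^ J))) powr (1 / real N))"
  proof (intro sum_mono mult_left_mono)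
    fix x assume x: "x \<in> X"
    have 1: "1 \<le> card (X \<inter> cball x s)" "1 \<le> card (X \<inter> cball x (s * 2 ^ J))"
      using x s assms(1) by (auto simp: Suc_le_eq card_gt_0_iff)
    have 2: "card (X \<inter> cball x (s * 2 ^ J)) \<le> card X"
      using assms(1) by (intro card_mono) auto
    have "card X powr (- 1 / N) = (1 / card X) powr (1 / real N)"
      by (simp add: powr_minus_divide powr_divide)
    also have "\<dots> \<le> (card (X \<inter> cball x s) / card (X \<inter> cball x (s * 2 ^ J))) powr (1 / real N)"
      using 1 2 by (intro powr_mono2 frac_le) auto
    finally show "card X powr (- 1 / N) \<le> \<dots>" .
  qed (simp add: w_def)
  also have "\<dots> \<le> sum w P" using c unfolding P_def by blast
  also have "\<dots> \<le> sum w padded"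
    using P padded_subset finite_padded by (intro sum_mono2) (auto simp: w_def)
  also have "\<dots> = card E'" using sumw[OF padded_subset] by (simp add: E'_def)
  finally have E': "card X powr (- 1 / N) * card E \<le> card E'" .
  obtain \<sigma> where \<sigma>: "real (card E') / 2 \<le> card {(x, y) \<in> E'. separates \<sigma> x y}"
    using exists_separating_signs[OF \<open>finite E'\<close>] lev assms(2) unfolding E'_def by blast
  \<comment> \<open>A nonempty \<open>E\<close> leaves some padded point, without which the
    extension would be a minimum over the empty set.\<close>
  have "card X > 0" using False assms by (auto simp: card_gt_0_iff)
  then have "0 < card X powr (- 1 / N) * card E"
    using False finE by (auto simp: card_gt_0_iff)
  then have "E' \<noteq> {}" using E' by auto
  then have ne: "padded \<noteq> {}" by (auto simp: E'_def)
  \<comment> \<open>Dividing by 4 gives a contraction; together with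
    \<open>8 * s = 16 * N * t\<close> this produces the constant \<open>64 = 4 * 16\<close>.\<close>
  define g where "g x = extension \<sigma> x / 4" for x
  have "\<bar>g x - g y\<bar> \<le> dist x y" for x y
    using extension_lipschitz[OF ne, of \<sigma> x y] by (simp add: g_def abs_le_iff)
  moreover have "{(x, y) \<in> E'. separates \<sigma> x y} \<subseteq> {(x, y) \<in> E. dist x y \<le> 64 * real N * \<bar>g x - g y\<bar>}"
  proof safe
    fix x y assume xy: "(x, y) \<in> E'" "separates \<sigma> x y"
    then show "(x, y) \<in> E" by (simp add: E'_def)
    have "dist x y \<le> 8 * (s * 2 ^ level x y)" using xy lev by (auto simp: E'_def)
    also have "\<dots> = 16 * real N * (t * 2 ^ level x y)" using assms(4) by (simp add: t_def)
    also have "\<dots> \<le> 16 * real N * \<bar>extension \<sigma> x - extension \<sigma> y\<bar>"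
      using xy(2) unfolding separates_def by (intro mult_left_mono) auto
    also have "\<dots> = 64 * real N * \<bar>g x - g y\<bar>" by (simp add: g_def abs_if field_simps)
    finally show "dist x y \<le> 64 * real N * \<bar>g x - g y\<bar>" .
  qed
  then have "card {(x, y) \<in> E'. separates \<sigma> x y} \<le> card {(x, y) \<in> E. dist x y \<le> 64 * real N * \<bar>g x - g y\<bar>}"
    by (intro card_mono finite_subset[OF _ finE]) auto
  ultimately show ?thesis using E' \<sigma> by (intro exI[of _ g]) auto
qed

section \<open>Greedy selection and amplification\<close>

text \<open>Each new function is chosen for the pairs still uncovered and removes a fraction
  \<open>\<eta>\<close> of them.\<close>

lemma greedy_cover:
  fixes \<eta> :: real
  assumes "finite E" "\<eta> \<le> 1"
    and step: "\<And>E'. E' \<subseteq> E \<Longrightarrow> \<exists>g\<in>G. \<eta> * card E' \<le> card {e\<in>E'. P g e}"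
  shows "\<exists>g::nat \<Rightarrow> 'b. (\<forall>l<k. g l \<in> G) \<and> card {e\<in>E. \<forall>l<k. \<not> P (g l) e} \<le> (1 - \<eta>) ^ k * card E"
proof (induction k)
  case 0
  then show ?case by simp
next
  case (Suc k)
  then obtain g where g: "\<And>l. l < k \<Longrightarrow> g l \<in> G"
      "card {e\<in>E. \<forall>l<k. \<not> P (g l) e} \<le> (1 - \<eta>) ^ k * card E" by blast
  define E' where "E' = {e\<in>E. \<forall>l<k. \<not> P (g l) e}"
  have E': "E' \<subseteq> E" "finite E'" using assms(1) by (auto simp: E'_def)
  obtain h where h: "h \<in> G" "\<eta> * card E' \<le> card {e\<in>E'. P h e}" using step[OF E'(1)] by blast
  have "card {e\<in>E'. \<not> P h e} + card {e\<in>E'. P h e} = card E'"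
    using E'(2) by (subst card_Un_disjoint[symmetric]) (auto intro!: arg_cong[of _ _ card])
  then have "card {e\<in>E'. \<not> P h e} \<le> (1 - \<eta>) * card E'" using h(2) by (simp add: algebra_simps)
  also have "\<dots> \<le> (1 - \<eta>) * ((1 - \<eta>) ^ k * card E)"
    using g(2) assms(2) unfolding E'_def by (intro mult_left_mono) auto
  also have "{e\<in>E'. \<not> P h e} = {e\<in>E. \<forall>l<Suc k. \<not> P ((g(k := h)) l) e}"
    by (auto simp: E'_def less_Suc_eq)
  finally show ?case using g(1) h(1) by (intro exI[of _ "g(k := h)"]) (auto simp: less_Suc_eq)
qed

definition contractions :: "('a::metric_space \<Rightarrow> real) set" where
  "contractions = {g. \<forall>x y. \<bar>g x - g y\<bar> \<le> dist x y}"

definition covers :: "real \<Rightarrow> ('a::metric_space \<Rightarrow> real) \<Rightarrow> 'a \<times> 'a \<Rightarrow> bool" where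
  "covers r g e \<longleftrightarrow> dist (fst e) (snd e) \<le> r * \<bar>g (fst e) - g (snd e)\<bar>"

text \<open>Anticoncentration on a grid: once the other coefficients are fixed, at most one value of
  the \<^term>\<open>l\<close>-th coefficient makes the sum smaller than half the \<^term>\<open>l\<close>-th increment.\<close>

lemma card_small_combinations:
  fixes u :: "nat \<Rightarrow> real" and T M :: nat
  assumes "l < M"
  defines "\<Omega> \<equiv> PiE {..<M} (\<lambda>_. {1..T})"
  shows "T * card {\<omega>\<in>\<Omega>. 2 * \<bar>\<Sum>i<M. real (\<omega> i) * u i\<bar> < \<bar>u l\<bar>} \<le> T ^ M"
proof -
  define B where "B = {\<omega>\<in>\<Omega>. 2 * \<bar>\<Sum>i<M. real (\<omega> i) * u i\<bar> < \<bar>u l\<bar>}"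
  \<comment> \<open>If two bad points differ only in coordinate \<open>l\<close>, their sums differ
    by an integer multiple of \<open>u l\<close> that is smaller than \<open>u l\<close> in modulus,
    hence by zero.\<close>
  have "inj_on (\<lambda>\<omega>. restrict \<omega> ({..<M} - {l})) B"
  proof (rule inj_onI)
    fix \<omega> \<omega>' assume \<omega>: "\<omega> \<in> B" "\<omega>' \<in> B" and eq: "restrict \<omega> ({..<M} - {l}) = restrict \<omega>' ({..<M} - {l})"
    have off: "\<omega> i = \<omega>' i" if "i < M" "i \<noteq> l" for i
      using fun_cong[OF eq, of i] that by simp
    have split: "(\<Sum>i<M. real (\<nu> i) * u i) = real (\<nu> l) * u l + (\<Sum>i\<in>{..<M} - {l}. real (\<nu> i) * u i)" for \<nu> :: "nat \<Rightarrow> nat"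
      using assms(1) by (intro sum.remove) auto
    have "(\<Sum>i\<in>{..<M} - {l}. real (\<omega> i) * u i) = (\<Sum>i\<in>{..<M} - {l}. real (\<omega>' i) * u i)"
      using off by (intro sum.cong) auto
    then have "(real (\<omega> l) - real (\<omega>' l)) * u l = (\<Sum>i<M. real (\<omega> i) * u i) - (\<Sum>i<M. real (\<omega>' i) * u i)"
      unfolding split by (simp add: algebra_simps)
    then have "\<bar>real (\<omega> l) - real (\<omega>' l)\<bar> * \<bar>u l\<bar> < 1 * \<bar>u l\<bar>"
      using \<omega> unfolding abs_mult[symmetric] B_def by auto
    then have "\<bar>real (\<omega> l) - real (\<omega>' l)\<bar> < 1"
      by (rule mult_right_less_imp_less) simp
    then have "\<omega> l = \<omega>' l" by linarith
    then show "\<omega> = \<omega>'"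
      using \<omega> off unfolding B_def \<Omega>_def by (intro PiE_ext[of \<omega> "{..<M}" "\<lambda>_. {1..T}" \<omega>']) auto
  qed
  moreover have "(\<lambda>\<omega>. restrict \<omega> ({..<M} - {l})) ` B \<subseteq> PiE ({..<M} - {l}) (\<lambda>_. {1..T})"
  proof (intro image_subsetI PiE_I)
    fix \<omega> i assume "\<omega> \<in> B" "i \<in> {..<M} - {l}"
    then show "restrict \<omega> ({..<M} - {l}) i \<in> {1..T}"
      using PiE_mem[of \<omega> "{..<M}" "\<lambda>_. {1..T}" i] by (simp add: B_def \<Omega>_def)
  qed auto
  moreover have "finite (PiE ({..<M} - {l}) (\<lambda>_. {1..T}))" by (intro finite_PiE) auto
  ultimately have "card B \<le> card (PiE ({..<M} - {l}) (\<lambda>_. {1..T}))" by (rule card_inj_on_le)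
  also have "\<dots> = T ^ (M - 1)" using assms(1) by (simp add: card_PiE)
  finally have "T * card B \<le> T * T ^ (M - 1)" by simp
  also have "\<dots> = T ^ M" using assms(1) by (cases M) auto
  finally show ?thesis by (simp add: B_def)
qed

text \<open>\<open>M\<close> greedy functions leave a fraction \<open>(1 - \<eta>) ^ M\<close>
  uncovered. A random integer combination of them misses each covered pair with probability at most
  \<open>1 / T\<close>, and some combination does as well as the average.\<close>

lemma amplified_cover:
  fixes E :: "('a::metric_space \<times> 'a) set" and \<eta> r :: real and T M :: nat
  assumes "finite E" "\<eta> \<le> 1" "0 \<le> r" "T \<ge> 1" "M \<ge> 1"
    and step: "\<And>E'. E' \<subseteq> E \<Longrightarrow> \<exists>g\<in>contractions. \<eta> * card E' \<le> card {e\<in>E'. covers r g e}"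
  shows "\<exists>h\<in>contractions. (1 - (1 - \<eta>) ^ M - 1 / T) * card E \<le> card {e\<in>E. covers (2 * real T * real M * r) h e}"
proof -
  obtain g where g: "\<forall>l<M. g l \<in> contractions"
      and un: "card {e\<in>E. \<forall>l<M. \<not> covers r (g l) e} \<le> (1 - \<eta>) ^ M * card E"
    using greedy_cover[OF assms(1,2) step] by blast
  define \<Omega> where "\<Omega> = PiE {..<M} (\<lambda>_. {1..T})"
  \<comment> \<open>Dividing by \<open>T * M\<close> yields a contraction and costs that factor in
    the distortion; the further factor 2 comes from \<open>card_small_combinations\<close>.\<close>
  define h where "h \<omega> x = (\<Sum>i<M. real (\<omega> i) * g i x) / (T * M)" for \<omega> :: "nat \<Rightarrow> nat" and x
  have \<Omega>: "finite \<Omega>" "\<Omega> \<noteq> {}" "card \<Omega> = T ^ M"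
    using assms(4) by (auto simp: \<Omega>_def card_PiE intro!: finite_PiE simp: PiE_eq_empty_iff)
  have hd: "h \<omega> x - h \<omega> y = (\<Sum>i<M. real (\<omega> i) * (g i x - g i y)) / (T * M)" for \<omega> x y
    by (simp add: h_def sum_subtractf right_diff_distrib diff_divide_distrib)
  have hc: "h \<omega> \<in> contractions" if "\<omega> \<in> \<Omega>" for \<omega>
    unfolding contractions_def
  proof safe
    fix x y
    have "\<bar>\<Sum>i<M. real (\<omega> i) * (g i x - g i y)\<bar> \<le> (\<Sum>i<M. \<bar>real (\<omega> i) * (g i x - g i y)\<bar>)"
      by (rule sum_abs)
    also have "\<dots> \<le> (\<Sum>i<M. T * dist x y)"
    proof (rule sum_mono)
      fix i assume i: "i \<in> {..<M}"
      then have "\<omega> i \<le> T" using PiE_mem[OF that[unfolded \<Omega>_def]] by simp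
      moreover have "\<bar>g i x - g i y\<bar> \<le> dist x y" using g i unfolding contractions_def by blast
      ultimately show "\<bar>real (\<omega> i) * (g i x - g i y)\<bar> \<le> T * dist x y"
        unfolding abs_mult by (intro mult_mono) auto
    qed
    finally have "\<bar>\<Sum>i<M. real (\<omega> i) * (g i x - g i y)\<bar> \<le> dist x y * (T * M)" by (simp add: mult_ac)
    then show "\<bar>h \<omega> x - h \<omega> y\<bar> \<le> dist x y"
      unfolding hd abs_divide using assms(4,5) by (simp add: divide_le_eq)
  qed
  define C where "C = {e\<in>E. \<exists>l<M. covers r (g l) e}"
  have finC: "finite C" using assms(1) by (simp add: C_def)
  have bad: "(\<Sum>\<omega>\<in>\<Omega>. of_bool (\<not> covers (2 * real T * real M * r) (h \<omega>) e) :: real) \<le> card \<Omega> / T" if e: "e \<in> C" for e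
  proof -
    obtain x y where xy: "e = (x, y)" by (cases e)
    obtain l where l: "l < M" "covers r (g l) e" using e by (auto simp: C_def)
    define u where "u i = g i x - g i y" for i
    have "{\<omega>\<in>\<Omega>. \<not> covers (2 * real T * real M * r) (h \<omega>) e} \<subseteq> {\<omega>\<in>\<Omega>. 2 * \<bar>\<Sum>i<M. real (\<omega> i) * u i\<bar> < \<bar>u l\<bar>}"
    proof safe
      fix \<omega> assume "\<not> covers (2 * real T * real M * r) (h \<omega>) e"
      then have "2 * real T * real M * r * \<bar>h \<omega> x - h \<omega> y\<bar> < r * \<bar>u l\<bar>"
        using l(2) by (auto simp: covers_def xy u_def)
      moreover have "2 * real T * real M * r * \<bar>h \<omega> x - h \<omega> y\<bar> = r * (2 * \<bar>\<Sum>i<M. real (\<omega> i) * u i\<bar>)"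
        using assms(4,5) by (simp add: hd u_def abs_divide)
      ultimately have "r * (2 * \<bar>\<Sum>i<M. real (\<omega> i) * u i\<bar>) < r * \<bar>u l\<bar>" by linarith
      then show "2 * \<bar>\<Sum>i<M. real (\<omega> i) * u i\<bar> < \<bar>u l\<bar>"
        using assms(3) by (rule mult_left_less_imp_less)
    qed
    then have "card {\<omega>\<in>\<Omega>. \<not> covers (2 * real T * real M * r) (h \<omega>) e} \<le> card {\<omega>\<in>\<Omega>. 2 * \<bar>\<Sum>i<M. real (\<omega> i) * u i\<bar> < \<bar>u l\<bar>}"
      using \<Omega>(1) by (intro card_mono) auto
    then have "T * card {\<omega>\<in>\<Omega>. \<not> covers (2 * real T * real M * r) (h \<omega>) e}
        \<le> T * card {\<omega>\<in>\<Omega>. 2 * \<bar>\<Sum>i<M. real (\<omega> i) * u i\<bar> < \<bar>u l\<bar>}"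
      by (rule mult_le_mono2)
    also have "\<dots> \<le> card \<Omega>"
      using card_small_combinations[OF l(1), of T u] \<Omega>(3) unfolding \<Omega>_def[symmetric] by simp
    finally have "T * card {\<omega>\<in>\<Omega>. \<not> covers (2 * real T * real M * r) (h \<omega>) e} \<le> card \<Omega>" .
    then have "real T * card {\<omega>\<in>\<Omega>. \<not> covers (2 * real T * real M * r) (h \<omega>) e} \<le> card \<Omega>"
      by (simp only: of_nat_mult[symmetric] of_nat_le_iff)
    then have "card {\<omega>\<in>\<Omega>. \<not> covers (2 * real T * real M * r) (h \<omega>) e} \<le> card \<Omega> / T"
      using assms(4) by (simp add: field_simps)
    then show ?thesis using \<Omega>(1) by (simp add: of_bool_def sum.If_cases Int_def)
  qed
  have "(\<Sum>\<omega>\<in>\<Omega>. real (card {e\<in>C. \<not> covers (2 * real T * real M * r) (h \<omega>) e}))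
      = (\<Sum>\<omega>\<in>\<Omega>. \<Sum>e\<in>C. of_bool (\<not> covers (2 * real T * real M * r) (h \<omega>) e))"
    using finC by (simp add: of_bool_def sum.If_cases Int_def)
  also have "\<dots> = (\<Sum>e\<in>C. \<Sum>\<omega>\<in>\<Omega>. of_bool (\<not> covers (2 * real T * real M * r) (h \<omega>) e))"
    by (rule sum.swap)
  also have "\<dots> \<le> (\<Sum>e\<in>C. card \<Omega> / T)" by (intro sum_mono bad)
  \<comment> \<open>The signs are reversed because \<open>exists_ge_average\<close> finds a value
    above the average.\<close>
  finally have "card \<Omega> * (- (card C / T)) \<le> (\<Sum>\<omega>\<in>\<Omega>. - real (card {e\<in>C. \<not> covers (2 * real T * real M * r) (h \<omega>) e}))"
    by (simp add: sum_negf mult_ac)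
  then obtain \<omega> where \<omega>: "\<omega> \<in> \<Omega>" "card {e\<in>C. \<not> covers (2 * real T * real M * r) (h \<omega>) e} \<le> card C / T"
    using exists_ge_average[OF \<Omega>(1,2)] by fastforce
  define Q where "Q = {e\<in>E. covers (2 * real T * real M * r) (h \<omega>) e}"
  have "E \<subseteq> {e\<in>E. \<forall>l<M. \<not> covers r (g l) e} \<union> {e\<in>C. \<not> covers (2 * real T * real M * r) (h \<omega>) e} \<union> Q"
    by (auto simp: C_def Q_def)
  then have "card E \<le> card ({e\<in>E. \<forall>l<M. \<not> covers r (g l) e} \<union> {e\<in>C. \<not> covers (2 * real T * real M * r) (h \<omega>) e} \<union> Q)"
    using assms(1) finC by (intro card_mono) (auto simp: Q_def)
  also have "\<dots> \<le> card {e\<in>E. \<forall>l<M. \<not> covers r (g l) e} + card {e\<in>C. \<not> covers (2 * real T * real M * r) (h \<omega>) e} + card Q"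
    by (meson add_mono card_Un_le order_refl order_trans)
  finally have "real (card E) \<le> card {e\<in>E. \<forall>l<M. \<not> covers r (g l) e} + card {e\<in>C. \<not> covers (2 * real T * real M * r) (h \<omega>) e} + card Q"
    by (simp only: of_nat_add[symmetric] of_nat_le_iff)
  also have "\<dots> \<le> (1 - \<eta>) ^ M * card E + card C / T + card Q"
    using un \<omega>(2) by simp
  also have "card C / T \<le> card E / T"
    using assms(1) by (intro divide_right_mono) (auto simp: C_def intro!: card_mono)
  finally show ?thesis
    using hc[OF \<omega>(1)] unfolding Q_def by (intro bexI[of _ "h \<omega>"]) (auto simp: algebra_simps)
qed

section \<open>Coordinate embeddings and the upper bound\<close>

lemma covers_mono: "covers r g e \<Longrightarrow> r \<le> r' \<Longrightarrow> covers r' g e"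
  unfolding covers_def by (meson abs_ge_zero mult_right_mono order_trans)

text \<open>The vectors supported on the first \<open>k\<close> coordinates form a copy of
  \<open>k\<close>-dimensional sup-normed space inside \<open>linfty\<close>.\<close>

definition truncated :: "nat \<Rightarrow> (nat \<Rightarrow> real) \<Rightarrow> linfty" where
  "truncated k a = Bcontfun (\<lambda>i. if i < k then a i else 0)"

lemma truncated_apply: "apply_bcontfun (truncated k a) i = (if i < k then a i else 0)"
proof -
  have "range (\<lambda>i. if i < k then a i else 0) \<subseteq> insert 0 (a ` {..<k})" by auto
  then have "finite (range (\<lambda>i. if i < k then a i else 0))"
    by (rule finite_subset) auto
  then have "(\<lambda>i. if i < k then a i else 0) \<in> bcontfun"
    by (auto simp: bcontfun_def intro!: finite_imp_bounded)
  then show ?thesis by (simp add: truncated_def Bcontfun_inverse)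
qed

lemma apply_bcontfun_sum: "apply_bcontfun (sum f A) i = (\<Sum>x\<in>A. apply_bcontfun (f x) i)"
  by (induction A rule: infinite_finite_induct) auto

lemma fin_dim_subspace_truncated: "fin_dim_subspace (range (truncated k)) k"
proof -
  define e where "e j = truncated k (\<lambda>i. of_bool (i = j))" for j
  have e: "apply_bcontfun (e j) i = of_bool (i = j)" if "j < k" for i j
    using that by (auto simp: e_def truncated_apply)
  have inj: "inj_on e {..<k}"
  proof (rule inj_onI)
    fix i j assume ij: "i \<in> {..<k}" "j \<in> {..<k}" "e i = e j"
    then have "apply_bcontfun (e i) i = apply_bcontfun (e j) i" by simp
    then show "i = j" using e[of i i] e[of j i] ij by (simp split: if_splits)
  qed
  have indep: "independent (e ` {..<k})"
    unfolding independent_explicit_finite_subsets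
  proof (intro allI impI ballI)
    fix A u v assume A: "A \<subseteq> e ` {..<k}" "finite A" and s: "(\<Sum>v\<in>A. u v *\<^sub>R v) = 0" and v: "v \<in> A"
    obtain j where j: "j < k" "v = e j" using A v by auto
    have "0 = apply_bcontfun (\<Sum>v\<in>A. u v *\<^sub>R v) j" by (simp add: s)
    also have "\<dots> = (\<Sum>w\<in>A. u w * apply_bcontfun w j)"
      by (simp add: apply_bcontfun_sum)
    also have "\<dots> = (\<Sum>w\<in>{v}. u w * apply_bcontfun w j)"
    proof (rule sum.mono_neutral_right)
      show "\<forall>w\<in>A - {v}. u w * apply_bcontfun w j = 0"
      proof
        fix w assume w: "w \<in> A - {v}"
        then obtain i where i: "i < k" "w = e i" using A by auto
        then have "i \<noteq> j" using w j by auto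
        then show "u w * apply_bcontfun w j = 0" using e[OF i(1), of j] i(2) by simp
      qed
    qed (use A v in auto)
    also have "\<dots> = u v" using e[OF j(1), of j] j(2) by simp
    finally show "u v = 0" by simp
  qed
  have eq: "truncated k a = (\<Sum>j<k. a j *\<^sub>R e j)" for a
  proof (rule bcontfun_eqI)
    fix i
    have "(\<Sum>j<k. a j * apply_bcontfun (e j) i) = (\<Sum>j<k. a j * of_bool (i = j))"
      by (intro sum.cong) (auto simp: e)
    then show "apply_bcontfun (truncated k a) i = apply_bcontfun (\<Sum>j<k. a j *\<^sub>R e j) i"
      by (simp add: apply_bcontfun_sum truncated_apply of_bool_def if_distrib sum.delta cong: if_cong)
  qed
  have "truncated k a \<in> span (e ` {..<k})" for a
    unfolding eq by (intro span_sum span_scale span_base) auto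
  then have sub: "range (truncated k) \<subseteq> span (e ` {..<k})" by auto
  have subsp: "subspace (range (truncated k))"
    unfolding subspace_def
  proof (intro conjI ballI allI)
    have "0 = truncated k (\<lambda>_. 0)" by (rule bcontfun_eqI) (simp add: truncated_apply)
    then show "0 \<in> range (truncated k)" by blast
  next
    fix x y assume "x \<in> range (truncated k)" "y \<in> range (truncated k)"
    then obtain a b where "x = truncated k a" "y = truncated k b" by auto
    then have "x + y = truncated k (\<lambda>i. a i + b i)" by (intro bcontfun_eqI) (simp add: truncated_apply)
    then show "x + y \<in> range (truncated k)" by blast
  next
    fix r x assume "x \<in> range (truncated k)"
    then obtain a where "x = truncated k a" by auto
    then have "r *\<^sub>R x = truncated k (\<lambda>i. r * a i)" by (intro bcontfun_eqI) (simp add: truncated_apply)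
    then show "r *\<^sub>R x \<in> range (truncated k)" by blast
  qed
  have "e ` {..<k} \<subseteq> range (truncated k)" by (auto simp: e_def)
  then have span: "span (e ` {..<k}) = range (truncated k)"
    using sub subsp by (meson span_minimal subset_antisym)
  then have "dim (range (truncated k)) = k"
    using indep inj by (metis card_image card_lessThan dim_span_eq_card_independent)
  then show ?thesis using subsp span unfolding fin_dim_subspace_def by blast
qed

text \<open>The functions become the coordinates of the map: contractions in each coordinate
  contract the supremum norm, and one covering coordinate per pair gives the lower estimate.\<close>

lemma reduces_to_dim_linftyI:
  assumes "\<And>S::linfty set. finite S \<Longrightarrow> card S = n \<Longrightarrow>
    \<exists>g::nat \<Rightarrow> linfty \<Rightarrow> real. (\<forall>l<k. g l \<in> contractions) \<and>
      (\<forall>x\<in>S. \<forall>y\<in>S. x \<noteq> y \<longrightarrow> (\<exists>l<k. covers \<alpha> (g l) (x, y)))" and "0 \<le> \<alpha>"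
  shows "reduces_to_dim TYPE(linfty) n \<alpha> k"
  unfolding reduces_to_dim_def
proof (intro allI impI)
  fix S :: "linfty set" assume S: "finite S \<and> card S = n"
  obtain g :: "nat \<Rightarrow> linfty \<Rightarrow> real" where gcov: "(\<forall>l<k. g l \<in> contractions) \<and>
      (\<forall>x\<in>S. \<forall>y\<in>S. x \<noteq> y \<longrightarrow> (\<exists>l<k. covers \<alpha> (g l) (x, y)))"
    using assms(1)[OF conjunct1[OF S] conjunct2[OF S]] ..
  have g: "g l \<in> contractions" if "l < k" for l using gcov that by simp
  have cov: "\<exists>l<k. covers \<alpha> (g l) (x, y)" if "x \<in> S" "y \<in> S" "x \<noteq> y" for x y
    using conjunct2[OF gcov] that by simp
  define f where "f x = truncated k (\<lambda>l. g l x)" for x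
  have le: "\<bar>g l x - g l y\<bar> \<le> norm (f x - f y)" if "l < k" for l x y
  proof -
    have "\<bar>apply_bcontfun (f x - f y) l\<bar> \<le> norm (f x - f y)" using norm_bounded[of "f x - f y" l] by simp
    then show ?thesis using that by (simp add: f_def truncated_apply)
  qed
  show "\<exists>(F::linfty set) f. fin_dim_subspace F k \<and> f ` S \<subseteq> F \<and> (\<forall>s\<in>S. \<forall>s'\<in>S. norm (f s - f s') \<le> norm (s - s') \<and>
                             norm (s - s') \<le> \<alpha> * norm (f s - f s'))"
  proof (intro exI[of _ "range (truncated k)"] exI[of _ f] conjI ballI)
    show "fin_dim_subspace (range (truncated k)) k" by (rule fin_dim_subspace_truncated)
    show "f ` S \<subseteq> range (truncated k)" by (auto simp: f_def)
    fix x y assume xy: "x \<in> S" "y \<in> S"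
    show "norm (f x - f y) \<le> norm (x - y)"
    proof (rule norm_bound)
      fix i
      show "norm (apply_bcontfun (f x - f y) i) \<le> norm (x - y)"
        using g[of i] by (auto simp: f_def truncated_apply contractions_def dist_norm)
    qed
    show "norm (x - y) \<le> \<alpha> * norm (f x - f y)"
    proof (cases "x = y")
      case False
      then obtain l where l: "l < k" "covers \<alpha> (g l) (x, y)" using cov xy by blast
      then have "norm (x - y) \<le> \<alpha> * \<bar>g l x - g l y\<bar>" by (simp add: covers_def dist_norm)
      also have "\<dots> \<le> \<alpha> * norm (f x - f y)" using le[OF l(1)] assms(2) by (intro mult_left_mono) auto
      finally show ?thesis .
    qed simp
  qed
qed

text \<open>There are at most \<open>n ^ 2\<close> pairs, so after \<open>k\<close> greedy steps
  fewer than one, hence none, is uncovered.\<close>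

lemma reduces_to_dim_linfty_if_cover:
  fixes \<eta> \<alpha> :: real
  assumes "\<eta> \<le> 1" "0 \<le> \<alpha>" "(1 - \<eta>) ^ k * (real n)\<^sup>2 < 1"
    and step: "\<And>(S::linfty set) E. finite S \<Longrightarrow> card S = n \<Longrightarrow> E \<subseteq> S \<times> S - Id \<Longrightarrow>
      \<exists>g\<in>contractions. \<eta> * card E \<le> card {e\<in>E. covers \<alpha> g e}"
  shows "reduces_to_dim TYPE(linfty) n \<alpha> k"
proof (rule reduces_to_dim_linftyI)
  fix S :: "linfty set" assume S: "finite S" "card S = n"
  define E where "E = S \<times> S - Id"
  have finE: "finite E" using S by (auto simp: E_def)
  have "card E \<le> card (S \<times> S)" using S by (intro card_mono) (auto simp: E_def)
  then have cE: "card E \<le> (real n)\<^sup>2"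
    using S by (simp add: card_cartesian_product power2_eq_square flip: of_nat_mult)
  obtain g where g: "(\<forall>l<k. g l \<in> contractions) \<and> card {e\<in>E. \<forall>l<k. \<not> covers \<alpha> (g l) e} \<le> (1 - \<eta>) ^ k * card E"
  proof -
    have "\<exists>g::nat \<Rightarrow> linfty \<Rightarrow> real. (\<forall>l<k. g l \<in> contractions) \<and>
        card {e\<in>E. \<forall>l<k. \<not> covers \<alpha> (g l) e} \<le> (1 - \<eta>) ^ k * card E"
      by (rule greedy_cover[OF finE assms(1)], rule step[OF S]) (auto simp: E_def)
    then show thesis by (elim exE) (rule that)
  qed
  have "(1 - \<eta>) ^ k * card E \<le> (1 - \<eta>) ^ k * (real n)\<^sup>2"
    using cE assms(1) by (intro mult_left_mono) auto
  then have "card {e\<in>E. \<forall>l<k. \<not> covers \<alpha> (g l) e} < (1::real)" using conjunct2[OF g] assms(3) by linarith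
  then have "{e\<in>E. \<forall>l<k. \<not> covers \<alpha> (g l) e} = {}" using finE by simp
  then have "\<forall>x\<in>S. \<forall>y\<in>S. x \<noteq> y \<longrightarrow> (\<exists>l<k. covers \<alpha> (g l) (x, y))"
    unfolding E_def by blast
  then show "\<exists>g. (\<forall>l<k. g l \<in> contractions) \<and> (\<forall>x\<in>S. \<forall>y\<in>S. x \<noteq> y \<longrightarrow> (\<exists>l<k. covers \<alpha> (g l) (x, y)))"
    using conjunct1[OF g] by (intro exI[of _ g] conjI)
qed fact

lemma exists_covering_contraction:
  fixes S :: "'a::metric_space set" and N :: nat
  assumes "finite S" "E \<subseteq> S \<times> S - Id" "N \<ge> 1"
  shows "\<exists>g\<in>contractions. card S powr (- 1 / N) / 2 * card E \<le> card {e\<in>E. covers (64 * real N) g e}"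
proof -
  obtain g where g: "\<forall>x y. \<bar>g x - g y\<bar> \<le> dist x y"
    "card S powr (- 1 / N) / 2 * card E \<le> card {(x, y) \<in> E. dist x y \<le> 64 * real N * \<bar>g x - g y\<bar>}"
    using exists_separating_function[OF assms(1) _ _ assms(3), of E] assms(2) by blast
  moreover have "{e\<in>E. covers (64 * real N) g e} = {(x, y) \<in> E. dist x y \<le> 64 * real N * \<bar>g x - g y\<bar>}"
    by (auto simp: covers_def)
  ultimately show ?thesis by (intro bexI[of _ g]) (auto simp: contractions_def)
qed

text \<open>Without amplification, for bounded \<open>\<alpha> / ln n\<close>.\<close>

lemma reduces_to_dim_linfty_log:
  fixes \<alpha> :: real and N :: nat
  defines "\<eta> \<equiv> \<lambda>n. real n powr (- 1 / real N) / 2"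
  assumes "n \<ge> 1" "N \<ge> 1" "64 * real N \<le> \<alpha>" "(1 - \<eta> n) ^ k * (real n)\<^sup>2 < 1"
  shows "reduces_to_dim TYPE(linfty) n \<alpha> k"
proof (rule reduces_to_dim_linfty_if_cover)
  have "real n powr (- 1 / real N) \<le> real n powr 0" using assms by (intro powr_mono) auto
  then show "\<eta> n \<le> 1" by (simp add: \<eta>_def split: if_splits)
  show "0 \<le> \<alpha>" using assms(4) by (meson mult_nonneg_nonneg of_nat_0_le_iff order_trans zero_le_numeral)
  fix S :: "linfty set" and E assume S: "finite S" "card S = n" "E \<subseteq> S \<times> S - Id"
  then obtain g where g: "g \<in> contractions" "\<eta> n * card E \<le> card {e\<in>E. covers (64 * real N) g e}"
    using exists_covering_contraction[OF S(1,3) assms(3)] by (auto simp: \<eta>_def)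
  have "finite E" using S finite_subset by blast
  then have "card {e\<in>E. covers (64 * real N) g e} \<le> card {e\<in>E. covers \<alpha> g e}"
    using covers_mono[OF _ assms(4)] by (intro card_mono) auto
  then show "\<exists>g\<in>contractions. \<eta> n * card E \<le> card {e\<in>E. covers \<alpha> g e}"
    using g by (intro bexI[of _ g]) auto
qed fact

text \<open>With amplification, for large \<open>\<alpha> / ln n\<close>.\<close>

lemma reduces_to_dim_linfty_amplified:
  fixes \<alpha> :: real and N T M :: nat
  defines "\<eta> \<equiv> \<lambda>n. real n powr (- 1 / real N) / 2"
  assumes "n \<ge> 1" "N \<ge> 1" "T \<ge> 1" "M \<ge> 1" "2 * real T * real M * (64 * real N) \<le> \<alpha>"
    "((1 - \<eta> n) ^ M + 1 / T) ^ k * (real n)\<^sup>2 < 1"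
  shows "reduces_to_dim TYPE(linfty) n \<alpha> k"
proof (rule reduces_to_dim_linfty_if_cover[where \<eta> = "1 - (1 - \<eta> n) ^ M - 1 / T"])
  have "real n powr (- 1 / real N) \<le> real n powr 0" using assms by (intro powr_mono) auto
  then have \<eta>: "\<eta> n \<le> 1" by (simp add: \<eta>_def split: if_splits)
  then have "0 \<le> (1 - \<eta> n) ^ M" "0 \<le> 1 / real T" by simp_all
  then show "1 - (1 - \<eta> n) ^ M - 1 / T \<le> 1" by linarith
  show "0 \<le> \<alpha>" by (rule order_trans[OF _ assms(6)]) simp
  show "(1 - (1 - (1 - \<eta> n) ^ M - 1 / T)) ^ k * (real n)\<^sup>2 < 1" using assms(7) by simp
  fix S :: "linfty set" and E assume S: "finite S" "card S = n" "E \<subseteq> S \<times> S - Id"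
  have fin: "finite E" using S finite_subset by blast
  have "\<exists>g\<in>contractions. \<eta> n * card E' \<le> card {e\<in>E'. covers (64 * real N) g e}" if "E' \<subseteq> E" for E'
    using exists_covering_contraction[OF S(1) _ assms(3), of E'] that S by (auto simp: \<eta>_def)
  then obtain g where g: "g \<in> contractions" "(1 - (1 - \<eta> n) ^ M - 1 / T) * card E \<le>
      card {e\<in>E. covers (2 * real T * real M * (64 * real N)) g e}"
    using amplified_cover[OF fin \<eta> _ assms(4,5), of "64 * real N"] by auto
  have "card {e\<in>E. covers (2 * real T * real M * (64 * real N)) g e} \<le> card {e\<in>E. covers \<alpha> g e}"
    using covers_mono[OF _ assms(6)] fin by (intro card_mono) auto
  then show "\<exists>g\<in>contractions. (1 - (1 - \<eta> n) ^ M - 1 / T) * card E \<le> card {e\<in>E. covers \<alpha> g e}"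
    using g by (intro bexI[of _ g]) auto
qed

lemma power_one_minus_le_exp:
  fixes x y :: real
  assumes "y \<le> x" "x \<le> 1"
  shows "(1 - x) ^ k \<le> exp (- y * k)"
proof -
  have "1 - x \<le> exp (- y)" using exp_ge_add_one_self[of "- y"] assms by linarith
  then have "(1 - x) ^ k \<le> exp (- y) ^ k" using assms by (intro power_mono) auto
  also have "\<dots> = exp (- y * k)" by (simp add: exp_of_nat_mult[symmetric] mult.commute)
  finally show ?thesis .
qed

lemma linfty_upper_bound:
  fixes \<beta> :: real
  assumes "\<beta> > 0"
  shows "\<exists>(C::real) (n\<^sub>0::nat). \<forall>(n::nat) (\<alpha>::real). n\<^sub>0 \<le> n \<and> \<beta> * ln (real n) \<le> \<alpha> \<and> \<alpha> \<le> real n \<longrightarrow>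
    (\<exists>k. reduces_to_dim TYPE(linfty) n \<alpha> k \<and> real k \<le> C * (ln (real n) / ln (\<alpha> / ln (real n) + 1)))"
proof -
  \<comment> \<open>The minimum lets \<open>64 * N \<le> b * L\<close> stay below both
    \<open>\<alpha>\<close> and \<open>L\<close>.\<close>
  define b where "b = min \<beta> 1"
  have b: "0 < b" "b \<le> 1" "b \<le> \<beta>" using assms by (auto simp: b_def)
  \<comment> \<open>As \<open>N\<close> will be at least \<open>b * L / 128\<close>,
    \<open>n powr (- 1 / N)\<close> is at least \<open>exp (- 128 / b)\<close>: one function covers
    a constant fraction.\<close>
  define \<eta> where "\<eta> = exp (- 128 / b) / 2"
  have \<eta>: "0 < \<eta>" "\<eta> \<le> 1 / 2" using b by (auto simp: \<eta>_def)
  \<comment> \<open>The first condition will give \<open>M \<le> sqrt K / 2\<close>, the second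
    \<open>2 / T \<le> (K + 1) powr (- 1 / 4)\<close>, the third \<open>T \<ge> 1\<close>.\<close>
  have "eventually (\<lambda>K::real. ln K / \<eta> + 2 \<le> sqrt K / 2 \<and> (K + 1) powr (1 / 4) \<le> (sqrt K - 1) / 2 \<and> 4 \<le> K) at_top"
    using \<eta>(1) by (intro eventually_conj; real_asymp)
  then obtain K1 where K1: "\<And>K. K1 \<le> K \<Longrightarrow> ln K / \<eta> + 2 \<le> sqrt K / 2"
      "\<And>K. K1 \<le> K \<Longrightarrow> (K + 1) powr (1 / 4) \<le> (sqrt K - 1) / 2" "\<And>K. K1 \<le> K \<Longrightarrow> 4 \<le> K"
    unfolding eventually_at_top_linorder by blast
  have "eventually (\<lambda>n::nat. 128 / b \<le> ln (real n)) at_top"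
    using b by real_asymp
  then obtain m :: nat where m: "\<And>n. m \<le> n \<Longrightarrow> 128 / b \<le> ln (real n)"
    unfolding eventually_at_top_linorder by blast
  define n0 where "n0 = max m 2"
  have n0: "128 / b \<le> ln (real n)" "2 \<le> n" if "n0 \<le> n" for n
    using m[of n] that by (auto simp: n0_def)
  \<comment> \<open>The entry 9 serves large \<open>K\<close>, the other one
    \<open>K \<le> K1\<close>, where \<open>ln (K + 1)\<close> is bounded.\<close>
  define C where "C = max 9 (4 / \<eta> * ln (K1 + 1))"
  show ?thesis
  proof (rule exI[of _ C], rule exI[of _ n0], intro allI impI)
    fix n :: nat and \<alpha> :: real
    assume n\<alpha>: "n0 \<le> n \<and> \<beta> * ln (real n) \<le> \<alpha> \<and> \<alpha> \<le> real n"
    define L where "L = ln (real n)"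
    define K where "K = \<alpha> / L"
    have n: "2 \<le> n" using n0 n\<alpha> by blast
    have L: "128 / b \<le> L" using n0 n\<alpha> by (auto simp: L_def)
    have "128 \<le> 128 / b" using b by (simp add: field_simps)
    then have L2: "128 \<le> L" using L by linarith
    have nL: "real n = exp L" using n by (simp add: L_def)
    have n2: "(real n)\<^sup>2 = exp (2 * L)" by (simp only: nL exp_double)
    have \<alpha>: "\<alpha> = K * L" using L2 by (simp add: K_def)
    have K: "\<beta> \<le> K" using n\<alpha> L2 by (simp add: K_def L_def field_simps)
    have KL: "ln (K + 1) \<le> L"
    \<comment> \<open>The bound on \<open>\<alpha>\<close> by \<open>n\<close> enters here; the
      inequality later absorbs the rounding of \<open>k\<close>.\<close>
    proof -
      have "K \<le> n / 2"
        using n\<alpha> L2 unfolding K_def by (intro frac_le) auto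
      then have "K + 1 \<le> n" using n by simp
      then show ?thesis using K assms by (simp add: L_def)
    qed
    have lnK: "0 < ln (K + 1)" using K assms by simp
    define N where "N = nat \<lfloor>b * L / 64\<rfloor>"
    have bL: "2 \<le> b * L / 64" using L b by (simp add: field_simps)
    have N: "real N \<le> b * L / 64" "b * L / 128 \<le> real N"
      using bL unfolding N_def by linarith+
    have N1: "1 \<le> N" using N bL by linarith
    have "64 * real N \<le> b * L" using N by simp
    also have "b * L \<le> \<alpha>" using b L2 K unfolding \<alpha> by (intro mult_right_mono) auto
    finally have N\<alpha>: "64 * real N \<le> \<alpha>" .
    have N2: "64 * real N \<le> L" using \<open>64 * real N \<le> b * L\<close> b L2 mult_right_mono[of b 1 L] by linarith
    define \<eta>n where "\<eta>n = real n powr (- 1 / real N) / 2"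
    have \<eta>n: "\<eta> \<le> \<eta>n" "\<eta>n \<le> 1"
    proof -
      have eq: "\<eta>n = exp (- (L / N)) / 2" using n by (simp add: \<eta>n_def powr_def L_def)
      have "L / N \<le> L / (b * L / 128)" using N N1 b L2
        by (intro divide_left_mono mult_pos_pos) auto
      also have "\<dots> = 128 / b" using L2 by simp
      finally show "\<eta> \<le> \<eta>n" by (simp add: eq \<eta>_def)
      have "exp (- (L / N)) \<le> 1" using L2 by simp
      then show "\<eta>n \<le> 1" unfolding eq by linarith
    qed
    show "\<exists>k. reduces_to_dim TYPE(linfty) n \<alpha> k \<and> real k \<le> C * (ln (real n) / ln (\<alpha> / ln (real n) + 1))"
    proof (cases "K \<le> K1")
      case True
      \<comment> \<open>As \<open>1 - \<eta>n \<le> exp (- \<eta>)\<close>, more than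
        \<open>2 * L / \<eta>\<close> functions outweigh the \<open>exp (2 * L)\<close>
        pairs.\<close>
      define k where "k = nat \<lceil>2 * L / \<eta>\<rceil> + 1"
      have k: "2 * L / \<eta> < k" "k \<le> 2 * L / \<eta> + 2"
        using L2 \<eta> divide_nonneg_pos[of "2 * L" \<eta>] unfolding k_def by linarith+
      have "(1 - \<eta>n) ^ k * (real n)\<^sup>2 \<le> exp (- \<eta> * k) * (real n)\<^sup>2"
        using power_one_minus_le_exp[OF \<eta>n, of k] by (intro mult_right_mono) auto
      also have "\<dots> = exp (2 * L - \<eta> * k)" by (simp add: n2 mult_exp_exp)
      also have "\<dots> < 1" using k \<eta> by (simp add: field_simps)
      finally have "reduces_to_dim TYPE(linfty) n \<alpha> k"
        using N1 N\<alpha> n unfolding \<eta>n_def by (intro reduces_to_dim_linfty_log[of n N]) auto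
      moreover have "k \<le> C * (L / ln (K + 1))"
      proof -
        have "2 \<le> 2 * L / \<eta>" using L2 \<eta> by (simp add: field_simps)
        then have "k \<le> 4 / \<eta> * L" using k by simp
        also have "\<dots> = 4 / \<eta> * ln (K + 1) * (L / ln (K + 1))" using lnK by simp
        also have "\<dots> \<le> C * (L / ln (K + 1))"
        proof (rule mult_right_mono)
          have "4 / \<eta> * ln (K + 1) \<le> 4 / \<eta> * ln (K1 + 1)"
            using True K assms \<eta> by (intro mult_left_mono) auto
          then show "4 / \<eta> * ln (K + 1) \<le> C" by (simp add: C_def)
        qed (use L2 lnK in auto)
        finally show ?thesis .
      qed
      ultimately show ?thesis by (auto simp: L_def K_def)
    next
      case False
      then have K2: "ln K / \<eta> + 2 \<le> sqrt K / 2" "(K + 1) powr (1 / 4) \<le> (sqrt K - 1) / 2" "4 \<le> K"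
        using K1[of K] by auto
      \<comment> \<open>\<open>T\<close> near \<open>sqrt K\<close> and \<open>M\<close> of order
        \<open>ln T\<close> keep the distortion below \<open>K * L\<close>, while each amplified
        function misses at most a fraction \<open>2 / T\<close>.\<close>
      define T where "T = nat \<lfloor>sqrt K\<rfloor>"
      define M where "M = nat \<lceil>ln T / \<eta>\<rceil> + 1"
      have sq: "2 \<le> sqrt K" using K2(3) real_le_rsqrt[of 2 K] by simp
      have T: "T \<le> sqrt K" "sqrt K - 1 \<le> T" "1 \<le> T"
        using sq unfolding T_def by linarith+
      have lnT: "0 \<le> ln T" using T(3) by simp
      have M: "ln T / \<eta> \<le> M" "M \<le> ln T / \<eta> + 2" "1 \<le> M"
        using divide_nonneg_pos[OF lnT \<eta>(1)] unfolding M_def by linarith+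
      have "sqrt K \<le> K" using K2(3) by (simp add: real_le_lsqrt power2_eq_square)
      then have "ln T \<le> ln K" using T K2 by simp
      then have "M \<le> sqrt K / 2" using M(2) K2(1) \<eta> divide_right_mono[of "ln T" "ln K" \<eta>] by linarith
      then have TM: "real T * real M \<le> sqrt K * (sqrt K / 2)" using T K2(3) by (intro mult_mono) auto
      have "2 * real T * real M * (64 * real N) \<le> K * L"
        using TM N2 K2(3) by (intro mult_mono) (auto simp: real_sqrt_mult_self)
      then have c1: "2 * real T * real M * (64 * real N) \<le> \<alpha>" by (simp add: \<alpha>)
      have "(1 - \<eta>n) ^ M \<le> exp (- \<eta> * M)" by (rule power_one_minus_le_exp[OF \<eta>n])
      also have "\<dots> \<le> exp (- ln T)" using M(1) \<eta> by (simp add: field_simps)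
      also have "\<dots> = 1 / T" using T(3) by (simp add: exp_minus inverse_eq_divide)
      finally have "(1 - \<eta>n) ^ M + 1 / T \<le> 2 / T" by simp
      also have "\<dots> \<le> 1 / (K + 1) powr (1 / 4)"
      proof -
        have "0 < (K + 1) powr (1 / 4)" "(K + 1) powr (1 / 4) \<le> T / 2" using K2 T by (auto intro: order_trans)
        then have "1 / (T / 2) \<le> 1 / (K + 1) powr (1 / 4)" by (rule frac_le[OF zero_le_one order_refl])
        then show ?thesis by simp
      qed
      also have "\<dots> = exp (- (ln (K + 1) / 4))" using K2 by (simp add: powr_def exp_minus inverse_eq_divide)
      finally have \<theta>: "(1 - \<eta>n) ^ M + 1 / T \<le> exp (- (ln (K + 1) / 4))" .
      \<comment> \<open>Each function now leaves at most a fraction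
        \<open>exp (- ln (K + 1) / 4)\<close>, to be compared with \<open>exp (2 * L)\<close>
        pairs.\<close>
      define k where "k = nat \<lfloor>8 * L / ln (K + 1)\<rfloor> + 1"
      have "0 \<le> 8 * L / ln (K + 1)" using L2 lnK by simp
      then have k: "8 * L / ln (K + 1) < k" "k \<le> 8 * L / ln (K + 1) + 1"
        unfolding k_def by linarith+
      have "0 \<le> (1 - \<eta>n) ^ M + 1 / T" using \<eta>n by (intro add_nonneg_nonneg) auto
      then have "((1 - \<eta>n) ^ M + 1 / T) ^ k * (real n)\<^sup>2 \<le> exp (- (ln (K + 1) / 4)) ^ k * (real n)\<^sup>2"
        using \<theta> by (intro mult_right_mono power_mono) auto
      also have "\<dots> = exp (2 * L - k * (ln (K + 1) / 4))"
        by (simp add: n2 mult_exp_exp exp_of_nat_mult[symmetric])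
      also have "\<dots> < 1" using k lnK by (simp add: field_simps)
      finally have "reduces_to_dim TYPE(linfty) n \<alpha> k"
        using N1 T M c1 n unfolding \<eta>n_def by (intro reduces_to_dim_linfty_amplified[of n N T M]) auto
      moreover have "k \<le> C * (L / ln (K + 1))"
      proof -
        have "1 \<le> L / ln (K + 1)" using KL lnK by simp
        then have "k \<le> 9 * (L / ln (K + 1))" using k by simp
        also have "\<dots> \<le> C * (L / ln (K + 1))"
          using L2 lnK by (intro mult_right_mono) (auto simp: C_def)
        finally show ?thesis .
      qed
      ultimately show ?thesis by (auto simp: L_def K_def)
    qed
  qed
qed

section \<open>Packing in finite-dimensional subspaces\<close>

lemma bounded_linear_apply_bcontfun: "bounded_linear (\<lambda>v::linfty. apply_bcontfun v i)"
proof (rule bounded_linear_intro)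
  show "norm (apply_bcontfun v i) \<le> norm v * 1" for v :: linfty using norm_bounded[of v i] by simp
qed auto

text \<open>The residual \<open>q\<close> of the earlier expansion is bounded, vanishes on the
  earlier span and not at the new vector \<open>b\<close>, so one of its coordinates, normalized, is
  the new functional.\<close>

lemma exists_dual_functionals:
  fixes B :: "linfty set"
  assumes "finite B" "independent B"
  shows "\<exists>\<phi>. (\<forall>b\<in>B. bounded_linear (\<phi> b :: linfty \<Rightarrow> real)) \<and> (\<forall>v\<in>span B. (\<Sum>b\<in>B. \<phi> b v *\<^sub>R b) = v)"
  using assms
proof (induction B rule: finite_induct)
  case empty
  then show ?case by simp
next
  case (insert b B)
  have ind: "independent B" "b \<notin> span B"
    using insert.prems insert.hyps by (auto simp: independent_insert)
  obtain \<phi> :: "linfty \<Rightarrow> linfty \<Rightarrow> real" where \<phi>: "(\<forall>b\<in>B. bounded_linear (\<phi> b)) \<and> (\<forall>v\<in>span B. (\<Sum>b\<in>B. \<phi> b v *\<^sub>R b) = v)"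
    using insert.IH[OF ind(1)] ..
  define q where "q v = v - (\<Sum>b\<in>B. \<phi> b v *\<^sub>R b)" for v
  have "(\<Sum>b'\<in>B. \<phi> b' b *\<^sub>R b') \<in> span B" by (intro span_sum span_scale span_base)
  then have "q b \<noteq> 0" using ind(2) by (auto simp: q_def)
  then obtain i where i: "apply_bcontfun (q b) i \<noteq> 0"
    by (metis bcontfun_eqI zero_bcontfun.rep_eq)
  have q: "bounded_linear q"
    unfolding q_def using \<phi>
    by (intro bounded_linear_sub bounded_linear_ident bounded_linear_sum
        bounded_linear_compose[OF bounded_linear_scaleR_left]) auto
  define \<psi> where "\<psi> v = apply_bcontfun (q v) i / apply_bcontfun (q b) i" for v
  have \<psi>: "bounded_linear \<psi>"
    unfolding \<psi>_def
    by (intro bounded_linear_compose[OF bounded_linear_divide]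
        bounded_linear_compose[OF bounded_linear_apply_bcontfun q])
  have \<psi>b: "\<psi> b = 1" using i by (simp add: \<psi>_def)
  have \<psi>0: "\<psi> w = 0" if "w \<in> span B" for w
    using \<phi> that by (simp add: \<psi>_def q_def)
  define \<phi>' where "\<phi>' b' v = (if b' = b then \<psi> v else \<phi> b' v - \<psi> v * \<phi> b' b)" for b' v
  show ?case
  proof (intro exI[of _ \<phi>'] conjI ballI)
    fix b' assume b': "b' \<in> insert b B"
    show "bounded_linear (\<phi>' b')"
    proof (cases "b' = b")
      case True
      then have "\<phi>' b' = \<psi>" by (intro ext) (simp add: \<phi>'_def)
      then show ?thesis using \<psi> by simp
    next
      case False
      then have "bounded_linear (\<lambda>v. \<phi> b' v - \<psi> v * \<phi> b' b)"
        using \<phi> b' by (intro bounded_linear_sub bounded_linear_compose[OF bounded_linear_mult_left \<psi>]) auto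
      moreover have "\<phi>' b' = (\<lambda>v. \<phi> b' v - \<psi> v * \<phi> b' b)" using False by (intro ext) (simp add: \<phi>'_def)
      ultimately show ?thesis by simp
    qed
  next
    fix v assume "v \<in> span (insert b B)"
    then obtain a where a: "v - a *\<^sub>R b \<in> span B" by (auto simp: span_insert)
    have "\<psi> (v - a *\<^sub>R b) = \<psi> v - a * \<psi> b"
      using \<psi> by (simp add: bounded_linear.linear linear_diff linear_scale)
    then have va: "\<psi> v = a" using \<psi>0[OF a] \<psi>b by simp
    have "\<phi> b' v - a * \<phi> b' b = \<phi> b' (v - a *\<^sub>R b)" if "b' \<in> B" for b'
      using \<phi> that by (simp add: bounded_linear.linear linear_diff linear_scale)
    then have "(\<Sum>b'\<in>B. (\<phi> b' v - a * \<phi> b' b) *\<^sub>R b') = (\<Sum>b'\<in>B. \<phi> b' (v - a *\<^sub>R b) *\<^sub>R b')"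
      by (intro sum.cong) auto
    also have "\<dots> = v - a *\<^sub>R b" using \<phi> a by simp
    finally have "(\<Sum>b'\<in>B. (\<phi> b' v - a * \<phi> b' b) *\<^sub>R b') = v - a *\<^sub>R b" .
    moreover have "(\<Sum>b'\<in>B. \<phi>' b' v *\<^sub>R b') = (\<Sum>b'\<in>B. (\<phi> b' v - a * \<phi> b' b) *\<^sub>R b')"
      using insert.hyps(2) by (intro sum.cong) (auto simp: \<phi>'_def va)
    moreover have "(\<Sum>b'\<in>insert b B. \<phi>' b' v *\<^sub>R b') = \<phi>' b v *\<^sub>R b + (\<Sum>b'\<in>B. \<phi>' b' v *\<^sub>R b')"
      using insert.hyps by simp
    ultimately show "(\<Sum>b'\<in>insert b B. \<phi>' b' v *\<^sub>R b') = v"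
      by (simp add: \<phi>'_def va)
  qed
qed

definition separated :: "real \<Rightarrow> 'a::real_normed_vector set \<Rightarrow> bool" where
  "separated \<delta> P \<longleftrightarrow> (\<forall>p\<in>P. \<forall>q\<in>P. p \<noteq> q \<longrightarrow> \<delta> \<le> norm (p - q))"

lemma separatedD: "separated \<delta> P \<Longrightarrow> p \<in> P \<Longrightarrow> q \<in> P \<Longrightarrow> p \<noteq> q \<Longrightarrow> \<delta> \<le> norm (p - q)"
  by (simp add: separated_def)

lemma fin_dim_subspace_basis:
  assumes "fin_dim_subspace F k"
  obtains B where "finite B" "independent B" "span B = F" "card B = k"
proof -
  obtain B0 where B0: "finite B0" "span B0 = F" and F: "dim F = k"
    using assms by (auto simp: fin_dim_subspace_def)
  obtain B where B: "B \<subseteq> B0" "independent B" "B0 \<subseteq> span B"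
    using maximal_independent_subset[of B0] by blast
  have "span B = F"
    using B B0 by (metis span_mono span_span subset_antisym)
  then show thesis
    using that[of B] B B0 F by (metis dim_span_eq_card_independent finite_subset)
qed

text \<open>Rounding the coordinates in a basis is injective on separated sets. The constant depends
  on the subspace; \<open>unit_packing_bound\<close> removes it.\<close>

lemma packing_polynomial_bound:
  fixes F :: "linfty set"
  assumes "fin_dim_subspace F k"
  shows "\<exists>C>0. \<forall>R P. 1 \<le> R \<and> finite P \<and> P \<subseteq> F \<and> (\<forall>p\<in>P. norm p \<le> R) \<and> separated 1 P
    \<longrightarrow> real (card P) \<le> (C * R) ^ k"
proof -
  obtain B where B: "finite B" "independent B" "span B = F" "card B = k"
    using fin_dim_subspace_basis[OF assms] .
  obtain \<phi> :: "linfty \<Rightarrow> linfty \<Rightarrow> real" where \<phi>: "(\<forall>b\<in>B. bounded_linear (\<phi> b)) \<and> (\<forall>v\<in>span B. (\<Sum>b\<in>B. \<phi> b v *\<^sub>R b) = v)"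
    using exists_dual_functionals[OF B(1,2)] ..
  define A where "A = (\<Sum>b\<in>B. onorm (\<phi> b))"
  have on: "0 \<le> onorm (\<phi> b)" if "b \<in> B" for b using \<phi> that by (intro onorm_pos_le) auto
  have A: "0 \<le> A" unfolding A_def using on by (rule sum_nonneg)
  have \<phi>A: "\<bar>\<phi> b v\<bar> \<le> A * norm v" if "b \<in> B" for b v
  proof -
    have "\<bar>\<phi> b v\<bar> \<le> onorm (\<phi> b) * norm v" using \<phi> that onorm[of "\<phi> b" v] by simp
    also have "\<dots> \<le> A * norm v"
      unfolding A_def using on that B(1) by (intro mult_right_mono member_le_sum) auto
    finally show ?thesis .
  qed
  \<comment> \<open>Points whose coordinates differ by at most \<open>1 / s\<close> are at distance
    at most \<open>(s - 1) / s < 1\<close>.\<close>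
  define s where "s = (\<Sum>b\<in>B. norm b) + 1"
  have s: "1 \<le> s" by (simp add: s_def sum_nonneg)
  define C where "C = 2 * s * A + 3"
  show ?thesis
  proof (rule exI[of _ C], intro conjI allI impI)
    show "0 < C" using s A by (simp add: C_def add_nonneg_pos)
    fix R :: real and P :: "linfty set"
    assume P: "1 \<le> R \<and> finite P \<and> P \<subseteq> F \<and> (\<forall>p\<in>P. norm p \<le> R) \<and> separated 1 P"
    define M where "M = \<lceil>s * A * R\<rceil>"
    define e where "e p = restrict (\<lambda>b. \<lfloor>s * \<phi> b p\<rfloor>) B" for p
    have "0 \<le> s * A * R" using s A P by simp
    then have M: "0 \<le> M" "M \<le> s * A * R + 1" unfolding M_def by linarith+
    have "inj_on e P"
    proof (rule inj_onI, rule ccontr)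
      fix p q assume pq: "p \<in> P" "q \<in> P" "e p = e q" "p \<noteq> q"
      have pqF: "p - q \<in> span B" using pq P B(3) by (auto intro: span_diff)
      have small: "\<bar>\<phi> b (p - q)\<bar> \<le> 1 / s" if "b \<in> B" for b
      proof -
        have "\<lfloor>s * \<phi> b p\<rfloor> = \<lfloor>s * \<phi> b q\<rfloor>" using fun_cong[OF pq(3), of b] that by (simp add: e_def)
        then have "\<bar>s * \<phi> b p - s * \<phi> b q\<bar> \<le> 1" by linarith
        moreover have "\<phi> b (p - q) = \<phi> b p - \<phi> b q"
          using \<phi> that by (simp add: bounded_linear.linear linear_diff)
        ultimately have "s * \<bar>\<phi> b (p - q)\<bar> \<le> 1" using s by (simp add: right_diff_distrib[symmetric] abs_mult)
        then show ?thesis using s by (simp add: field_simps)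
      qed
      have "(\<Sum>b\<in>B. norm (\<phi> b (p - q) *\<^sub>R b)) \<le> (\<Sum>b\<in>B. 1 / s * norm b)"
        unfolding norm_scaleR using small by (intro sum_mono mult_right_mono) auto
      also have "\<dots> = (s - 1) / s" by (simp add: s_def sum_divide_distrib[symmetric])
      also have "\<dots> < 1" using s by simp
      finally have "norm (\<Sum>b\<in>B. \<phi> b (p - q) *\<^sub>R b) < 1" 
        using norm_sum[of "\<lambda>b. \<phi> b (p - q) *\<^sub>R b" B] by linarith
      then have "norm (p - q) < 1" using \<phi> pqF by simp
      then show False using separatedD[of 1 P p q] P pq by simp
    qed
    moreover have "e ` P \<subseteq> PiE B (\<lambda>_. {- M..M})"
    proof (intro image_subsetI PiE_I)
      fix p b assume p: "p \<in> P" and b: "b \<in> B"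
      have "\<bar>\<phi> b p\<bar> \<le> A * norm p" by (rule \<phi>A[OF b])
      also have "\<dots> \<le> A * R" using P p A by (intro mult_left_mono) auto
      finally have "\<bar>s * \<phi> b p\<bar> \<le> s * (A * R)"
        unfolding abs_mult using s by (intro mult_mono) auto
      then have "\<bar>s * \<phi> b p\<bar> \<le> of_int M" unfolding M_def by (simp add: mult.assoc) linarith
      then show "e p b \<in> {- M..M}" using b unfolding e_def by (simp, linarith)
    qed (auto simp: e_def)
    moreover have "finite (PiE B (\<lambda>_. {- M..M}))" using B by (intro finite_PiE) auto
    ultimately have "card P \<le> card (PiE B (\<lambda>_. {- M..M}))" by (rule card_inj_on_le)
    also have "\<dots> = nat (2 * M + 1) ^ k" using B by (simp add: card_PiE)
    finally have "real (card P) \<le> real (nat (2 * M + 1) ^ k)" by (simp only: of_nat_le_iff)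
    also have "\<dots> = of_int (2 * M + 1) ^ k" using M(1) by simp
    also have "\<dots> \<le> (C * R) ^ k"
    proof (rule power_mono)
      have "of_int (2 * M + 1) \<le> 2 * (s * A * R) + 3" using M(2) by simp
      also have "\<dots> \<le> C * R" using P by (simp add: C_def algebra_simps)
      finally show "of_int (2 * M + 1) \<le> C * R" .
    qed (use M in simp)
    finally show "real (card P) \<le> (C * R) ^ k" .
  qed
qed

text \<open>No Lebesgue measure on the subspace is needed: superposing rescaled copies of a packing gives
  packings of \<^term>\<open>card P ^ m\<close> points in balls of radius about \<^term>\<open>(2 * t + 1) ^ m\<close>, and
  for large \<^term>\<open>m\<close> a polynomial bound with any constant becomes sharp.\<close>

lemma unit_packing_bound:
  fixes F :: "linfty set"
  assumes F: "fin_dim_subspace F k" and P: "finite P" "P \<subseteq> F" "\<And>p. p \<in> P \<Longrightarrow> norm p \<le> t" "separated 1 P"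
    and "0 \<le> t"
  shows "real (card P) \<le> (2 * t + 1) ^ k"
proof (rule ccontr)
  assume not: "\<not> ?thesis"
  define l where "l = 2 * t + 1"
  have l: "1 \<le> l" using \<open>0 \<le> t\<close> by (simp add: l_def)
  have sub: "subspace F" using F by (simp add: fin_dim_subspace_def)
  obtain C where C: "0 < C" "\<forall>R P. 1 \<le> R \<and> finite P \<and> P \<subseteq> F \<and> (\<forall>p\<in>P. norm p \<le> R) \<and> separated 1 P
    \<longrightarrow> real (card P) \<le> (C * R) ^ k"
    using packing_polynomial_bound[OF F] by (elim exE conjE)
  \<comment> \<open>Differences in \<open>P\<close> scaled by \<open>l ^ m\<close> have norm at
    least \<open>l ^ m\<close>; adding elements of \<open>Q\<close> costs at most
    \<open>l ^ m - 1\<close> of it and leaves separation 1.\<close>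
  have "\<exists>Q. finite Q \<and> Q \<subseteq> F \<and> card Q = card P ^ m \<and> (\<forall>q\<in>Q. 2 * norm q \<le> l ^ m - 1) \<and> separated 1 Q" for m
  proof (induction m)
    case 0
    then show ?case using sub by (intro exI[of _ "{0}"]) (auto simp: separated_def subspace_0)
  next
    case (Suc m)
    then obtain Q where Q: "finite Q" "Q \<subseteq> F" "card Q = card P ^ m" "\<forall>q\<in>Q. 2 * norm q \<le> l ^ m - 1" "separated 1 Q"
      by (elim exE conjE)
    define c where "c = (\<lambda>(p::linfty, q). l ^ m *\<^sub>R p + q)"
    have sep: "1 \<le> norm (c (p, q) - c (p', q'))"
      if "p \<in> P" "q \<in> Q" "p' \<in> P" "q' \<in> Q" "(p, q) \<noteq> (p', q')" for p q p' q'
    proof (cases "p = p'")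
      case True
      then show ?thesis using that separatedD[OF Q(5)] by (simp add: c_def)
    next
      case False
      have "l ^ m * 1 \<le> l ^ m * norm (p - p')" using separatedD[OF P(4) that(1,3) False] l by (intro mult_left_mono) auto
      also have "\<dots> = norm (l ^ m *\<^sub>R (p - p'))" using l by simp
      also have "\<dots> = norm ((c (p, q) - c (p', q')) - (q - q'))" by (simp add: c_def algebra_simps)
      also have "\<dots> \<le> norm (c (p, q) - c (p', q')) + (norm q + norm q')"
        by (meson add_left_mono norm_triangle_ineq4 order_trans)
      finally show ?thesis using bspec[OF Q(4) that(2)] bspec[OF Q(4) that(4)] by linarith
    qed
    have inj: "inj_on c (P \<times> Q)"
    proof (rule inj_onI, rule ccontr)
      fix x y assume xy: "x \<in> P \<times> Q" "y \<in> P \<times> Q" "c x = c y" "x \<noteq> y"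
      then show False using sep[of "fst x" "snd x" "fst y" "snd y"] by auto
    qed
    show ?case
    proof (intro exI[of _ "c ` (P \<times> Q)"] conjI ballI)
      show "c ` (P \<times> Q) \<subseteq> F"
        using P(2) Q(2) sub by (auto simp: c_def intro!: subspace_add subspace_scale)
      show "card (c ` (P \<times> Q)) = card P ^ Suc m"
        using inj Q(3) by (simp add: card_image card_cartesian_product)
      show "separated 1 (c ` (P \<times> Q))" unfolding separated_def using sep by fastforce
      fix z assume "z \<in> c ` (P \<times> Q)"
      then obtain p q where pq: "p \<in> P" "q \<in> Q" "z = l ^ m *\<^sub>R p + q" by (auto simp: c_def)
      have "2 * norm z \<le> 2 * (l ^ m * norm p) + 2 * norm q"
        using norm_triangle_ineq[of "l ^ m *\<^sub>R p" q] pq(3) l by simp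
      also have "\<dots> \<le> 2 * (l ^ m * t) + (l ^ m - 1)"
        using P(3)[OF pq(1)] Q(4) pq(2) l by (intro add_mono mult_left_mono) auto
      also have "\<dots> = l ^ Suc m - 1" by (simp add: l_def algebra_simps)
      finally show "2 * norm z \<le> l ^ Suc m - 1" .
    qed (use P(1) Q(1) in simp)
  qed
  then have bound: "real (card P) ^ m \<le> C ^ k * (l ^ k) ^ m" for m
  proof -
    obtain Q where Q: "finite Q" "Q \<subseteq> F" "card Q = card P ^ m" "\<forall>q\<in>Q. 2 * norm q \<le> l ^ m - 1" "separated 1 Q"
      using \<open>\<And>m. \<exists>Q. finite Q \<and> Q \<subseteq> F \<and> card Q = card P ^ m \<and> (\<forall>q\<in>Q. 2 * norm q \<le> l ^ m - 1) \<and> separated 1 Q\<close>[of m]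
      by (elim exE conjE)
    have l1: "1 \<le> l ^ m" using l by simp
    have nq: "norm q \<le> l ^ m" if "q \<in> Q" for q
    proof -
      have "2 * norm q \<le> l ^ m - 1" using Q(4) that by blast
      then show ?thesis using norm_ge_zero[of q] by linarith
    qed
    have "real (card Q) \<le> (C * l ^ m) ^ k"
      using C(2) l1 Q(1,2,5) nq by blast
    then show ?thesis by (simp add: Q(3) power_mult_distrib power_mult[symmetric] mult.commute)
  qed
  \<comment> \<open>If \<open>card P\<close> exceeded \<open>l ^ k\<close>, powers of the quotient
    would outgrow the constant \<open>C ^ k\<close>.\<close>
  have lk: "0 < l ^ k" using l by simp
  have "1 < real (card P) / l ^ k" using not lk by (simp add: l_def)
  then obtain m where "C ^ k < (real (card P) / l ^ k) ^ m" using real_arch_pow by blast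
  then show False using bound[of m] lk by (simp add: power_divide field_simps)
qed

lemma packing_bound:
  fixes F :: "linfty set"
  assumes F: "fin_dim_subspace F k" and P: "finite P" "P \<subseteq> F" "x \<in> F" "\<And>p. p \<in> P \<Longrightarrow> norm (p - x) \<le> \<rho>"
    "separated \<delta> P" and "0 < \<delta>" "0 \<le> \<rho>"
  shows "real (card P) \<le> (2 * \<rho> / \<delta> + 1) ^ k"
proof -
  define f where "f p = (1 / \<delta>) *\<^sub>R (p - x)" for p
  have sub: "subspace F" using F by (simp add: fin_dim_subspace_def)
  have fd: "f p - f q = (1 / \<delta>) *\<^sub>R (p - q)" for p q by (simp add: f_def algebra_simps)
  have inj: "inj_on f P" using \<open>0 < \<delta>\<close> by (auto simp: inj_on_def f_def)
  have "real (card (f ` P)) \<le> (2 * (\<rho> / \<delta>) + 1) ^ k"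
  proof (rule unit_packing_bound[OF F])
    show "f ` P \<subseteq> F" using P(2,3) sub by (auto simp: f_def intro!: subspace_scale subspace_diff)
    show "norm q \<le> \<rho> / \<delta>" if "q \<in> f ` P" for q
      using that P(4) \<open>0 < \<delta>\<close> by (auto simp: f_def divide_right_mono)
    show "separated 1 (f ` P)"
      unfolding separated_def
    proof (intro ballI impI)
      fix u v assume "u \<in> f ` P" "v \<in> f ` P" "u \<noteq> v"
      then obtain p q where pq: "p \<in> P" "q \<in> P" "p \<noteq> q" "u = f p" "v = f q" by auto
      then show "1 \<le> norm (u - v)"
        using separatedD[OF P(5) pq(1-3)] \<open>0 < \<delta>\<close> by (simp add: fd)
    qed
  qed (use P assms in auto)
  then show ?thesis using inj by (simp add: card_image)
qed

text \<open>A largest \<open>\<delta>\<close>-separated subset is a net, as any point far from it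
  could be added; \<open>packing_bound\<close> ensures that a largest one exists.\<close>

lemma exists_net:
  fixes F :: "linfty set"
  assumes F: "fin_dim_subspace F k" and A: "A \<subseteq> F" "x \<in> F" "\<And>a. a \<in> A \<Longrightarrow> norm (a - x) \<le> \<rho>"
    and "0 < \<delta>" "0 \<le> \<rho>"
  shows "\<exists>P. finite P \<and> P \<subseteq> A \<and> real (card P) \<le> (2 * \<rho> / \<delta> + 1) ^ k \<and> (\<forall>a\<in>A. \<exists>p\<in>P. norm (a - p) < \<delta>)"
proof -
  define good where "good P \<longleftrightarrow> finite P \<and> P \<subseteq> A \<and> separated \<delta> P" for P
  have bound: "real (card P) \<le> (2 * \<rho> / \<delta> + 1) ^ k" if "good P" for P
    using that A assms by (intro packing_bound[OF F]) (auto simp: good_def)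
  have "good {}" by (simp add: good_def separated_def)
  moreover have "\<forall>P. good P \<longrightarrow> card P < Suc (nat \<lfloor>(2 * \<rho> / \<delta> + 1) ^ k\<rfloor>)"
    using bound by (auto simp: less_Suc_eq_le le_nat_floor)
  ultimately obtain P where P: "good P" "\<forall>Q. good Q \<longrightarrow> card Q \<le> card P"
    using ex_has_greatest_nat[of good "{}" card] by blast
  have "\<exists>p\<in>P. norm (a - p) < \<delta>" if a: "a \<in> A" for a
  proof (rule ccontr)
    assume "\<not> ?thesis"
    then have far: "\<delta> \<le> norm (a - p)" if "p \<in> P" for p using that by force
    then have "a \<notin> P" using \<open>0 < \<delta>\<close> by force
    have "good (insert a P)"
      using P(1) a far by (auto simp: good_def separated_def norm_minus_commute)
    then have "card (insert a P) \<le> card P" using P(2) by blast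
    then show False using \<open>a \<notin> P\<close> P(1) by (simp add: good_def)
  qed
  then show ?thesis using P(1) bound[OF P(1)] by (auto simp: good_def)
qed

section \<open>Counting graphs\<close>

text \<open>Loops make the \<open>r\<close>-th power relate vertices at distance at most
  \<open>r\<close> instead of those joined by walks of length exactly \<open>r\<close>.\<close>

definition step :: "(nat \<Rightarrow> nat) \<Rightarrow> nat \<Rightarrow> (nat \<times> nat) set" where
  "step p n = {(x, y). x < n \<and> y < n \<and> (x = y \<or> y = Suc x \<or> x = Suc y \<or> y = p x \<or> x = p y)}"

definition gdist :: "(nat \<Rightarrow> nat) \<Rightarrow> nat \<Rightarrow> nat \<Rightarrow> nat \<Rightarrow> nat" where
  "gdist p n x y = (LEAST r. (x, y) \<in> step p n ^^ r)"

lemma step_relpow_path: "x + r < n \<Longrightarrow> (x, x + r) \<in> step p n ^^ r"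
proof (induction r)
  case (Suc r)
  then have "(x, x + r) \<in> step p n ^^ r" "(x + r, x + Suc r) \<in> step p n" by (auto simp: step_def)
  then show ?case by (rule relpow_Suc_I)
qed simp

lemma step_relpow_sym: "(x, y) \<in> step p n ^^ r \<Longrightarrow> (y, x) \<in> step p n ^^ r"
proof (induction r arbitrary: y)
  case (Suc r)
  then obtain z where "(x, z) \<in> step p n ^^ r" "(z, y) \<in> step p n" by auto
  then have "(z, x) \<in> step p n ^^ r" "(y, z) \<in> step p n" using Suc.IH by (auto simp: step_def)
  then show ?case by (intro relpow_Suc_I2)
qed simp

lemma step_relpow_mono:
  assumes "(x, y) \<in> step p n ^^ r" "r \<le> r'" "y < n"
  shows "(x, y) \<in> step p n ^^ r'"
  using assms(2,1)
proof (induction r' rule: dec_induct)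
  case (step m)
  have "(y, y) \<in> step p n" using assms(3) by (simp add: step_def)
  then show ?case using step by (intro relpow_Suc_I) auto
qed

lemma step_relpow_gdist:
  assumes "x < n" "y < n"
  shows "(x, y) \<in> step p n ^^ gdist p n x y"
proof -
  have "\<exists>r. (x, y) \<in> step p n ^^ r"
  proof (cases "x \<le> y")
    case True
    then show ?thesis using step_relpow_path[of x "y - x" n p] assms by auto
  next
    case False
    then show ?thesis using step_relpow_path[of y "x - y" n p] step_relpow_sym assms by fastforce
  qed
  then show ?thesis unfolding gdist_def by (rule LeastI_ex)
qed

lemma gdist_le: "(x, y) \<in> step p n ^^ r \<Longrightarrow> gdist p n x y \<le> r"
  unfolding gdist_def by (rule Least_le)

lemma gdist_le_iff:
  assumes "x < n" "y < n"
  shows "gdist p n x y \<le> r \<longleftrightarrow> (x, y) \<in> step p n ^^ r"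
  using step_relpow_mono[OF step_relpow_gdist[OF assms] _ assms(2)] gdist_le by blast

lemma gdist_self [simp]: "x < n \<Longrightarrow> gdist p n x x = 0"
  using gdist_le[where r = 0] by simp

lemma gdist_eq_0: "x < n \<Longrightarrow> y < n \<Longrightarrow> gdist p n x y = 0 \<Longrightarrow> x = y"
  using gdist_le_iff[where r = 0] by simp

lemma gdist_commute:
  assumes "x < n" "y < n"
  shows "gdist p n x y = gdist p n y x"
proof (rule antisym)
  show "gdist p n x y \<le> gdist p n y x"
    by (intro gdist_le, rule step_relpow_sym, rule step_relpow_gdist[OF assms(2,1)])
  show "gdist p n y x \<le> gdist p n x y"
    by (intro gdist_le, rule step_relpow_sym, rule step_relpow_gdist[OF assms])
qed

lemma gdist_triangle:
  assumes "x < n" "y < n" "z < n"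
  shows "gdist p n x z \<le> gdist p n x y + gdist p n y z"
proof (rule gdist_le)
  show "(x, z) \<in> step p n ^^ (gdist p n x y + gdist p n y z)"
    unfolding relpow_add using step_relpow_gdist assms by blast
qed

lemma gdist_step: "(x, y) \<in> step p n \<Longrightarrow> gdist p n x y \<le> 1"
  by (rule gdist_le) simp

text \<open>One step reaches at most five vertices: the vertex itself, two on the path, its image
  and its preimage under \<open>p\<close>.\<close>

lemma card_gdist_ball:
  assumes "inj p" "x < n"
  shows "card {y. y < n \<and> gdist p n x y \<le> r} \<le> 5 ^ r"
proof -
  have nb: "card (step p n `` {x}) \<le> 5" for x
  proof -
    have "step p n `` {x} \<subseteq> {x, Suc x, x - 1, p x, the_inv p x}"
      using the_inv_f_f[OF assms(1)] by (auto simp: step_def)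
    then have "card (step p n `` {x}) \<le> card {x, Suc x, x - 1, p x, the_inv p x}"
      by (intro card_mono) auto
    also have "\<dots> \<le> 5" by (intro order_trans[OF card_insert_le_m1[of 5]] card_insert_le_m1) auto
    finally show ?thesis .
  qed
  have "finite ((step p n ^^ r) `` {x}) \<and> card ((step p n ^^ r) `` {x}) \<le> 5 ^ r"
  proof (induction r)
    case (Suc r)
    have eq: "(step p n ^^ Suc r) `` {x} = (\<Union>y\<in>(step p n ^^ r) `` {x}. step p n `` {y})" by auto
    have "card ((step p n ^^ Suc r) `` {x}) \<le> (\<Sum>y\<in>(step p n ^^ r) `` {x}. card (step p n `` {y}))"
      unfolding eq using Suc by (intro card_UN_le) auto
    also have "\<dots> \<le> (\<Sum>y\<in>(step p n ^^ r) `` {x}. 5)" by (intro sum_mono nb)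
    also have "\<dots> \<le> 5 ^ Suc r" using Suc by simp
    finally have "card ((step p n ^^ Suc r) `` {x}) \<le> 5 ^ Suc r" .
    moreover have "finite (step p n `` {y})" for y
      by (rule finite_subset[of _ "{..<n}"]) (auto simp: step_def)
    ultimately show ?case using Suc unfolding eq by auto
  qed simp
  moreover have "{y. y < n \<and> gdist p n x y \<le> r} \<subseteq> (step p n ^^ r) `` {x}"
    using gdist_le_iff[OF assms(2)] by auto
  ultimately show ?thesis by (meson card_mono order_trans)
qed

section \<open>Isometric copies of the graphs and codes for their embeddings\<close>

definition kuratowski :: "(nat \<Rightarrow> nat) \<Rightarrow> nat \<Rightarrow> nat \<Rightarrow> linfty" where
  "kuratowski p n x = truncated n (\<lambda>i. real (gdist p n x i))"

text \<open>The triangle inequality bounds every coordinate of the difference, and coordinate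
  \<open>y\<close> attains the bound.\<close>

lemma norm_kuratowski:
  assumes "x < n" "y < n"
  shows "norm (kuratowski p n x - kuratowski p n y) = gdist p n x y"
proof (rule antisym)
  have "real (gdist p n x i) \<le> gdist p n x y + gdist p n y i"
       "real (gdist p n y i) \<le> gdist p n x y + gdist p n x i" if "i < n" for i
    using gdist_triangle[of x n y i p] gdist_triangle[of y n x i p] gdist_commute[of x n y p] that assms by simp_all
  then show "norm (kuratowski p n x - kuratowski p n y) \<le> gdist p n x y"
    by (intro norm_bound) (auto simp: kuratowski_def truncated_apply abs_le_iff algebra_simps)
  show "gdist p n x y \<le> norm (kuratowski p n x - kuratowski p n y)"
    using norm_bounded[of "kuratowski p n x - kuratowski p n y" y] assms
    by (simp add: kuratowski_def truncated_apply)
qed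

lemma exists_surjection_lessThan:
  assumes "finite A" "A \<noteq> {}" "card A \<le> m"
  shows "\<exists>u. u ` {..<m::nat} = A"
proof -
  obtain h where h: "bij_betw h {0..<card A} A" using ex_bij_betw_nat_finite[OF assms(1)] by blast
  have c: "0 < card A" using assms by (simp add: card_gt_0_iff)
  define u where "u i = h (if i < card A then i else 0)" for i
  have hA: "h ` {0..<card A} = A" using h by (simp add: bij_betw_def)
  have "u ` {..<m} \<subseteq> A" using hA c by (auto simp: u_def)
  moreover have "A \<subseteq> u ` {..<m}"
  proof
    fix a assume "a \<in> A"
    then have "a \<in> h ` {0..<card A}" by (simp add: hA)
    then obtain i where "i < card A" "a = h i" by auto
    then show "a \<in> u ` {..<m}" using assms(3) by (intro image_eqI[of _ _ i]) (auto simp: u_def)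
  qed
  ultimately show ?thesis by blast
qed

text \<open>Numbers below \<open>c ^ k\<close> index the net, possibly with repetition, so that
  labels come from a set independent of the subspace.\<close>

lemma fin_dim_net:
  fixes F :: "linfty set"
  assumes F: "fin_dim_subspace F k" and "0 < \<delta>" "0 \<le> \<rho>" "2 * \<rho> / \<delta> + 1 = real c"
  shows "\<exists>u::nat \<Rightarrow> linfty. (\<forall>l<c^k. u l \<in> F \<and> norm (u l) \<le> \<rho>) \<and> (\<forall>a\<in>F. norm a \<le> \<rho> \<longrightarrow> (\<exists>l<c^k. norm (a - u l) < \<delta>))"
proof -
  define A where "A = {a\<in>F. norm a \<le> \<rho>}"
  have 0: "0 \<in> F" using F by (simp add: fin_dim_subspace_def subspace_0)
  obtain P where P: "finite P" "P \<subseteq> A" "real (card P) \<le> (2 * \<rho> / \<delta> + 1) ^ k" "\<forall>a\<in>A. \<exists>p\<in>P. norm (a - p) < \<delta>"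
    using exists_net[OF F _ 0 _ assms(2,3), of A] by (auto simp: A_def)
  have "real (card P) \<le> real (c ^ k)" using P(3) assms(4) by simp
  then have "card P \<le> c ^ k" by (simp only: of_nat_le_iff)
  moreover have "P \<noteq> {}" using P(4) 0 assms(3) by (auto simp: A_def)
  ultimately obtain u where u: "u ` {..<c ^ k} = P" using exists_surjection_lessThan[OF P(1)] by blast
  have "u l \<in> A" if "l < c ^ k" for l using u P(2) that by blast
  moreover have "\<exists>l<c ^ k. norm (a - u l) < \<delta>" if "a \<in> A" for a
    using P(4) that u by (metis (no_types, lifting) imageE lessThan_iff)
  ultimately show ?thesis by (intro exI[of _ u]) (auto simp: A_def)
qed

text \<open>Each point of a \<open>1 / 4\<close>-net of the unit ball contributes a coordinate
  attaining its norm up to \<open>1 / 8\<close>. A unit vector then exceeds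
  \<open>1 - 1 / 4 - 1 / 8 - 1 / 4 = 3 / 8\<close> at one of these.\<close>

lemma exists_norming_coordinates:
  fixes F :: "linfty set"
  assumes F: "fin_dim_subspace F k"
  shows "\<exists>\<iota>::nat \<Rightarrow> nat. \<forall>v\<in>F. \<forall>c. (\<forall>i<9^k. \<bar>apply_bcontfun v (\<iota> i)\<bar> \<le> c) \<longrightarrow> norm v \<le> 3 * c"
proof -
  obtain u :: "nat \<Rightarrow> linfty" where u: "\<forall>a\<in>F. norm a \<le> 1 \<longrightarrow> (\<exists>l<9^k. norm (a - u l) < 1 / 4)"
    using fin_dim_net[OF F, of "1/4" 1 9] by auto
  have "\<exists>j. norm (u l) - 1 / 8 < \<bar>apply_bcontfun (u l) j\<bar>" for l
  proof (rule ccontr)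
    assume "\<not> ?thesis"
    then have "norm (u l) \<le> norm (u l) - 1 / 8" by (intro norm_bound) (simp add: not_less)
    then show False by simp
  qed
  then obtain \<iota> where \<iota>: "\<And>l. norm (u l) - 1 / 8 < \<bar>apply_bcontfun (u l) (\<iota> l)\<bar>" by metis
  show ?thesis
  proof (intro exI[of _ \<iota>] ballI allI impI)
    fix v c assume v: "v \<in> F" and c: "\<forall>i<9^k. \<bar>apply_bcontfun v (\<iota> i)\<bar> \<le> c"
    have c0: "0 \<le> c" using c[rule_format, of 0] by simp
    show "norm v \<le> 3 * c"
    proof (cases "v = 0")
      case False
      define w where "w = (1 / norm v) *\<^sub>R v"
      have w: "w \<in> F" "norm w = 1"
        using v F False by (auto simp: w_def fin_dim_subspace_def subspace_scale)
      obtain l where l: "l < 9^k" "norm (w - u l) < 1 / 4" using u w by fastforce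
      have "norm w \<le> norm (u l) + norm (w - u l)" using norm_triangle_ineq[of "u l" "w - u l"] by simp
      moreover have "\<bar>apply_bcontfun (u l) (\<iota> l)\<bar> \<le> \<bar>apply_bcontfun w (\<iota> l)\<bar> + norm (w - u l)"
        using norm_bounded[of "w - u l" "\<iota> l"] by simp
      ultimately have "3 / 8 < \<bar>apply_bcontfun w (\<iota> l)\<bar>" using \<iota>[of l] l(2) w(2) by linarith
      also have "\<dots> = \<bar>apply_bcontfun v (\<iota> l)\<bar> / norm v" by (simp add: w_def abs_mult)
      also have "\<dots> \<le> c / norm v" using c l(1) by (intro divide_right_mono) auto
      finally have "3 / 8 * norm v < c" using False by (simp add: field_simps)
      then show ?thesis using c0 by linarith
    qed (use c0 in simp)
  qed
qed

text \<open>A code consists of a label for every step along the path and a table that holds, for every label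
  (a net point) and every norming coordinate, the coordinate in units of \<open>1 / n\<close>, rounded down.\<close>

definition position :: "(nat \<Rightarrow> nat) \<Rightarrow> (nat \<times> nat \<Rightarrow> int) \<Rightarrow> nat \<Rightarrow> nat \<Rightarrow> int" where
  "position lab tab x i = (\<Sum>j<x. tab (lab j, i))"

definition near :: "nat \<Rightarrow> nat \<Rightarrow> (nat \<Rightarrow> nat) \<times> (nat \<times> nat \<Rightarrow> int) \<Rightarrow> nat \<Rightarrow> nat \<Rightarrow> bool" where
  "near n k w x y \<longleftrightarrow> (\<forall>i<9^k. \<bar>position (fst w) (snd w) x i - position (fst w) (snd w) y i\<bar> \<le> 4 * int n)"

text \<open>The bases 5 and 9 come from nets: radius 2 and mesh 1 for the steps, radius 1 and mesh
  \<open>1 / 4\<close> for the coordinates. Steps of norm at most 2 give entries up to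
  \<open>2 * n\<close>.\<close>

definition codes :: "nat \<Rightarrow> nat \<Rightarrow> ((nat \<Rightarrow> nat) \<times> (nat \<times> nat \<Rightarrow> int)) set" where
  "codes n k = PiE {..<n} (\<lambda>_. {..<5^k}) \<times> PiE ({..<5^k} \<times> {..<9^k}) (\<lambda>_. {- 2 * int n..2 * int n})"

lemma finite_codes: "finite (codes n k)"
  unfolding codes_def by (intro finite_cartesian_product finite_PiE) auto

lemma card_codes: "card (codes n k) = (5 ^ k) ^ n * (4 * n + 1) ^ (45 ^ k)"
proof -
  have "nat (2 * int n + 1 - (- 2 * int n)) = 4 * n + 1" by simp
  moreover have "(5::nat) ^ k * 9 ^ k = 45 ^ k" by (simp flip: power_mult_distrib)
  ultimately show ?thesis by (simp add: codes_def card_cartesian_product card_PiE)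
qed

text \<open>The path through all vertices in their natural order is contained in all graphs. Following it and rounding each
  position relative to the previous rounded one costs only a factor \<^term>\<open>5 ^ k\<close> per vertex,
  and rounding errors do not accumulate.\<close>

lemma exists_code:
  fixes F :: "linfty set" and h :: "nat \<Rightarrow> linfty"
  assumes F: "fin_dim_subspace F k" and h: "\<And>x. x < n \<Longrightarrow> h x \<in> F"
    and path: "\<And>x. Suc x < n \<Longrightarrow> norm (h (Suc x) - h x) \<le> 1"
  shows "\<exists>w\<in>codes n k. \<forall>x<n. \<forall>y<n. (norm (h x - h y) \<le> 1 \<longrightarrow> near n k w x y) \<and>
    (near n k w x y \<longrightarrow> norm (h x - h y) \<le> 21)"
proof -
  have sub: "subspace F" using F by (simp add: fin_dim_subspace_def)
  obtain u :: "nat \<Rightarrow> linfty" where uF: "\<And>l. l < 5^k \<Longrightarrow> u l \<in> F" and u2: "\<And>l. l < 5^k \<Longrightarrow> norm (u l) \<le> 2"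
    and net: "\<And>a. a \<in> F \<Longrightarrow> norm a \<le> 2 \<Longrightarrow> \<exists>l<5^k. norm (a - u l) < 1"
    using fin_dim_net[OF F, of 1 2 5] by auto
  obtain \<iota> :: "nat \<Rightarrow> nat" where \<iota>: "\<forall>v\<in>F. \<forall>c. (\<forall>i<9^k. \<bar>apply_bcontfun v (\<iota> i)\<bar> \<le> c) \<longrightarrow> norm v \<le> 3 * c"
    using exists_norming_coordinates[OF F] ..
  define pick where "pick x a = (SOME l. l < 5^k \<and> norm (h (Suc x) - a - u l) < 1)" for x a
  \<comment> \<open>The rounded positions: the next vertex is within 2 of the previous rounded
    position, so a net of that ball restores the error bound 1.\<close>
  define s where "s = rec_nat (h 0) (\<lambda>x a. a + u (pick x a))"
  have s0: "s 0 = h 0" and sS: "s (Suc x) = s x + u (pick x (s x))" for x by (simp_all add: s_def)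
  have inv: "s x \<in> F \<and> norm (h x - s x) \<le> 1 \<and> (\<forall>j<x. pick j (s j) < 5^k)" if "x < n" for x
    using that
  proof (induction x)
    case 0
    then show ?case using h by (simp add: s0)
  next
    case (Suc x)
    then have IH: "s x \<in> F" "norm (h x - s x) \<le> 1" "\<forall>j<x. pick j (s j) < 5^k" by auto
    have "norm (h (Suc x) - s x) \<le> 2"
      using norm_triangle_ineq[of "h (Suc x) - h x" "h x - s x"] path[OF Suc.prems] IH(2) by simp
    moreover have "h (Suc x) - s x \<in> F" using h[OF Suc.prems] IH(1) sub by (intro subspace_diff)
    ultimately have "\<exists>l. l < 5^k \<and> norm (h (Suc x) - s x - u l) < 1" using net by blast
    then have p: "pick x (s x) < 5^k \<and> norm (h (Suc x) - s x - u (pick x (s x))) < 1"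
      unfolding pick_def by (rule someI_ex)
    then show ?case using IH uF sub by (auto simp: sS less_Suc_eq subspace_add algebra_simps)
  qed
  \<comment> \<open>No step starts at the last vertex; its label 0 is a default.\<close>
  define lab where "lab = restrict (\<lambda>j. if Suc j < n then pick j (s j) else 0) {..<n}"
  define tab where "tab = restrict (\<lambda>(l, i). \<lfloor>n * apply_bcontfun (u l) (\<iota> i)\<rfloor>) ({..<5^k} \<times> {..<9^k})"
  have lab5: "lab j < 5^k" if "j < n" for j
    using inv[of "Suc j"] that by (auto simp: lab_def)
  have s_lab: "s x = h 0 + (\<Sum>j<x. u (lab j))" if "x < n" for x
    using that by (induction x) (auto simp: s0 sS lab_def)
  \<comment> \<open>The accumulated rounding error of the table: at most one unit for each of fewer
    than \<open>n\<close> steps, hence at most 1 in length.\<close>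
  define D where "D x i = n * apply_bcontfun (s x - h 0) (\<iota> i) - position lab tab x i" for x i
  have D: "0 \<le> D x i" "D x i \<le> n" if "x < n" "i < 9^k" for x i
  proof -
    have "D x i = (\<Sum>j<x. n * apply_bcontfun (u (lab j)) (\<iota> i) - \<lfloor>n * apply_bcontfun (u (lab j)) (\<iota> i)\<rfloor>)"
      using that lab5 s_lab[OF that(1)]
      by (simp add: D_def position_def tab_def apply_bcontfun_sum sum_distrib_left sum_subtractf)
    moreover have "0 \<le> z - \<lfloor>z\<rfloor>" "z - \<lfloor>z\<rfloor> \<le> 1" for z :: real by linarith+
    ultimately have "0 \<le> D x i" "D x i \<le> (\<Sum>j<x. 1)"
      by (auto simp del: sum_constant intro!: sum_nonneg sum_mono)
    then show "0 \<le> D x i" "D x i \<le> n" using that(1) by auto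
  qed
  have diff: "\<bar>n * apply_bcontfun (s x - s y) (\<iota> i) - (position lab tab x i - position lab tab y i)\<bar> \<le> n"
    if "x < n" "y < n" "i < 9^k" for x y i
  proof -
    have "n * apply_bcontfun (s x - s y) (\<iota> i) - (position lab tab x i - position lab tab y i) = D x i - D y i"
      by (simp add: D_def algebra_simps)
    then show ?thesis using D[OF that(1,3)] D[OF that(2,3)] by linarith
  qed
  have hs: "norm ((h x - h y) - (s x - s y)) \<le> 2" if "x < n" "y < n" for x y
    using norm_triangle_ineq4[of "h x - s x" "h y - s y"] inv[OF that(1)] inv[OF that(2)] by (simp add: algebra_simps)
  have "(lab, tab) \<in> codes n k"
  proof -
    have "\<bar>n * apply_bcontfun (u l) j\<bar> \<le> 2 * n" if "l < 5^k" for l j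
      using norm_bounded[of "u l" j] u2[OF that] by (simp add: abs_mult mult.commute mult_left_mono)
    then have "\<lfloor>n * apply_bcontfun (u l) j\<rfloor> \<in> {- 2 * int n..2 * int n}" if "l < 5^k" for l j
      using that[THEN \<open>\<And>l j. l < 5^k \<Longrightarrow> \<bar>n * apply_bcontfun (u l) j\<bar> \<le> 2 * n\<close>, of j]
      by (simp add: le_floor_iff floor_le_iff abs_le_iff)
    then have "tab \<in> PiE ({..<5^k} \<times> {..<9^k}) (\<lambda>_. {- 2 * int n..2 * int n})"
      unfolding tab_def by (intro PiE_I) (auto simp: restrict_def split: if_splits)
    moreover have "lab \<in> PiE {..<n} (\<lambda>_. {..<5^k})"
      using lab5 by (intro PiE_I) (auto simp: lab_def)
    ultimately show ?thesis by (simp add: codes_def)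
  qed
  \<comment> \<open>Rounding positions turns distance 1 into at most 3, and the error of the table
    makes it 4.\<close>
  moreover have "near n k (lab, tab) x y" if xy: "x < n" "y < n" "norm (h x - h y) \<le> 1" for x y
    unfolding near_def
  proof (intro allI impI)
    fix i :: nat assume i: "i < 9 ^ k"
    have "norm (s x - s y) \<le> 3"
      using norm_triangle_ineq4[of "h x - h y" "(h x - h y) - (s x - s y)"] hs[OF xy(1,2)] xy(3) by simp
    then have "\<bar>n * apply_bcontfun (s x - s y) (\<iota> i)\<bar> \<le> real n * 3"
      unfolding abs_mult using norm_bounded[of "s x - s y" "\<iota> i"] by (intro mult_mono) auto
    then have "\<bar>real_of_int (position lab tab x i - position lab tab y i)\<bar> \<le> 4 * n"
      using diff[OF xy(1,2) i] by simp
    then have "real_of_int \<bar>position lab tab x i - position lab tab y i\<bar> \<le> real_of_int (4 * int n)" by simp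
    then show "\<bar>position (fst (lab, tab)) (snd (lab, tab)) x i - position (fst (lab, tab)) (snd (lab, tab)) y i\<bar> \<le> 4 * int n"
      unfolding of_int_le_iff by simp
  qed
  \<comment> \<open>Conversely each norming coordinate is at most \<open>4 + 1 + 2 = 7\<close>, and
    the norm at most three times that.\<close>
  moreover have "norm (h x - h y) \<le> 21" if xy: "x < n" "y < n" and near: "near n k (lab, tab) x y" for x y
  proof -
    have "\<bar>apply_bcontfun (h x - h y) (\<iota> i)\<bar> \<le> 7" if i: "i < 9^k" for i
    proof -
      have "\<bar>position lab tab x i - position lab tab y i\<bar> \<le> 4 * int n" using near i by (simp add: near_def)
      then have "real_of_int \<bar>position lab tab x i - position lab tab y i\<bar> \<le> real_of_int (4 * int n)"
        unfolding of_int_le_iff .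
      then have "\<bar>n * apply_bcontfun (s x - s y) (\<iota> i)\<bar> \<le> real n * 5"
        using diff[OF xy i] by simp
      then have "\<bar>apply_bcontfun (s x - s y) (\<iota> i)\<bar> \<le> 5"
        unfolding abs_mult using xy by (simp add: mult_le_cancel_left)
      moreover have "\<bar>apply_bcontfun ((h x - h y) - (s x - s y)) (\<iota> i)\<bar> \<le> 2"
        using norm_bounded[of "(h x - h y) - (s x - s y)" "\<iota> i"] hs[OF xy] by simp
      ultimately show ?thesis by simp
    qed
    moreover have "h x - h y \<in> F" using h xy sub by (intro subspace_diff) auto
    ultimately have "norm (h x - h y) \<le> 3 * 7" using \<iota> by blast
    then show ?thesis by simp
  qed
  ultimately show ?thesis by blast
qed

text \<open>Adjacent vertices \<open>x\<close> and \<open>p x\<close> are mapped within 1, hence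
  near. Vertices near \<open>x\<close> are mapped within 21 of its image: a net of their images is
  small, and the vertices mapped close to one net point lie in one graph ball.\<close>

lemma exists_good_code:
  fixes \<alpha> :: real and n k r :: nat
  assumes red: "reduces_to_dim TYPE(linfty) n \<alpha> k" and "0 < \<alpha>" and p: "p permutes {..<n}"
  shows "\<exists>w\<in>codes n k. \<forall>x<n. near n k w x (p x) \<and>
    real (card {y. y < n \<and> near n k w x y}) \<le> (42 * \<alpha> / (r + 1) + 1) ^ k * 5 ^ r"
proof -
  define S where "S = kuratowski p n ` {..<n}"
  have "inj_on (kuratowski p n) {..<n}"
  proof (rule inj_onI)
    fix x y assume "x \<in> {..<n}" "y \<in> {..<n}" "kuratowski p n x = kuratowski p n y"
    then show "x = y" using norm_kuratowski[of x n y p] gdist_eq_0[of x n y p] by simp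
  qed
  then have "finite S \<and> card S = n" by (simp add: S_def card_image)
  then obtain F :: "linfty set" and f where F: "fin_dim_subspace F k" and fS: "f ` S \<subseteq> F" and
    f: "\<forall>s\<in>S. \<forall>s'\<in>S. norm (f s - f s') \<le> norm (s - s') \<and> norm (s - s') \<le> \<alpha> * norm (f s - f s')"
    using red unfolding reduces_to_dim_def by blast
  define h where "h x = f (kuratowski p n x)" for x
  have hF: "h x \<in> F" if "x < n" for x using fS that by (auto simp: h_def S_def)
  have h: "norm (h x - h y) \<le> gdist p n x y" "gdist p n x y \<le> \<alpha> * norm (h x - h y)" if "x < n" "y < n" for x y
  proof -
    have "kuratowski p n x \<in> S" "kuratowski p n y \<in> S" using that by (auto simp: S_def)
    then show "norm (h x - h y) \<le> gdist p n x y" "gdist p n x y \<le> \<alpha> * norm (h x - h y)"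
      using f unfolding h_def norm_kuratowski[OF that, symmetric] by blast+
  qed
  have h1: "norm (h x - h y) \<le> 1" if "(x, y) \<in> step p n" for x y
    using h(1)[of x y] gdist_step[OF that] that by (simp add: step_def)
  have "\<exists>w\<in>codes n k. \<forall>x<n. \<forall>y<n. (norm (h x - h y) \<le> 1 \<longrightarrow> near n k w x y) \<and>
    (near n k w x y \<longrightarrow> norm (h x - h y) \<le> 21)"
    by (intro exists_code[OF F] hF h1) (simp_all add: step_def)
  then obtain w where w: "w \<in> codes n k" and w12: "\<forall>x<n. \<forall>y<n. (norm (h x - h y) \<le> 1 \<longrightarrow> near n k w x y) \<and>
    (near n k w x y \<longrightarrow> norm (h x - h y) \<le> 21)"
    by (elim bexE)
  have w1: "near n k w x y" if "x < n" "y < n" "norm (h x - h y) \<le> 1" for x y using w12 that by simp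
  have w2: "norm (h x - h y) \<le> 21" if "x < n" "y < n" "near n k w x y" for x y using w12 that by simp
  show ?thesis
  proof (intro bexI[OF _ w] allI impI conjI)
    fix x assume x: "x < n"
    then have "p x < n" using permutes_in_image[OF p, of x] by simp
    then show "near n k w x (p x)" using x by (intro w1 h1) (auto simp: step_def)
    define Y where "Y = {y. y < n \<and> near n k w x y}"
    \<comment> \<open>Images closer than \<open>\<delta>\<close> come from vertices at distance less
      than \<open>r + 1\<close>, thus at most \<open>r\<close>.\<close>
    define \<delta> where "\<delta> = (real r + 1) / \<alpha>"
    have \<delta>: "0 < \<delta>" using \<open>0 < \<alpha>\<close> by (simp add: \<delta>_def)
    have YF: "h ` Y \<subseteq> F" using hF by (auto simp: Y_def)
    have Y21: "norm (a - h x) \<le> 21" if "a \<in> h ` Y" for a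
      using that w2[OF x] by (auto simp: Y_def norm_minus_commute)
    obtain P where P: "finite P" "P \<subseteq> h ` Y" "real (card P) \<le> (2 * 21 / \<delta> + 1) ^ k" "\<forall>a\<in>h ` Y. \<exists>q\<in>P. norm (a - q) < \<delta>"
      using exists_net[OF F YF hF[OF x] Y21 \<delta>] by auto
    have "\<forall>q\<in>P. \<exists>y. y < n \<and> h y = q" using P(2) by (auto simp: Y_def)
    then obtain c where c: "\<And>q. q \<in> P \<Longrightarrow> c q < n \<and> h (c q) = q" by metis
    have "Y \<subseteq> (\<Union>q\<in>P. {y. y < n \<and> gdist p n (c q) y \<le> r})"
    proof
      fix y assume y: "y \<in> Y"
      then obtain q where q: "q \<in> P" "norm (h y - q) < \<delta>" using P(4) by blast
      have yn: "y < n" using y by (simp add: Y_def)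
      have "real (gdist p n (c q) y) \<le> \<alpha> * norm (h y - q)"
        using h(2)[of "c q" y] c[OF q(1)] yn by (simp add: norm_minus_commute)
      also have "\<dots> < \<alpha> * \<delta>" using q(2) \<open>0 < \<alpha>\<close> by simp
      also have "\<dots> = real r + 1" using \<open>0 < \<alpha>\<close> by (simp add: \<delta>_def)
      finally have "gdist p n (c q) y \<le> r" by linarith
      then show "y \<in> (\<Union>q\<in>P. {y. y < n \<and> gdist p n (c q) y \<le> r})" using q(1) yn by blast
    qed
    then have "card Y \<le> card (\<Union>q\<in>P. {y. y < n \<and> gdist p n (c q) y \<le> r})"
      using P(1) by (intro card_mono) auto
    also have "\<dots> \<le> (\<Sum>q\<in>P. card {y. y < n \<and> gdist p n (c q) y \<le> r})"
      using P(1) by (rule card_UN_le)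
    also have "\<dots> \<le> (\<Sum>q\<in>P. 5 ^ r)"
      using c permutes_inj[OF p] by (intro sum_mono card_gdist_ball) auto
    finally have "card Y \<le> card P * 5 ^ r" by simp
    then have "real (card Y) \<le> real (card P * 5 ^ r)" by (simp only: of_nat_le_iff)
    also have "\<dots> \<le> (2 * 21 / \<delta> + 1) ^ k * 5 ^ r" using P(3) by simp
    also have "2 * 21 / \<delta> = 42 * \<alpha> / (r + 1)" by (simp add: \<delta>_def)
    finally show "real (card {y. y < n \<and> near n k w x y}) \<le> (42 * \<alpha> / (r + 1) + 1) ^ k * 5 ^ r"
      by (simp add: Y_def)
  qed
qed

section \<open>Counting permutations and the lower bound\<close>

lemma card_restricted_permutations:
  fixes R :: "nat \<Rightarrow> nat \<Rightarrow> bool" and \<Delta> :: real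
  assumes "\<And>x. x < n \<Longrightarrow> real (card {y. y < n \<and> R x y}) \<le> \<Delta>"
  shows "real (card {p. p permutes {..<n} \<and> (\<forall>x<n. R x (p x))}) \<le> \<Delta> ^ n"
proof -
  define A where "A = {p. p permutes {..<n} \<and> (\<forall>x<n. R x (p x))}"
  define Q where "Q = PiE {..<n} (\<lambda>x. {y. y < n \<and> R x y})"
  have "inj_on (\<lambda>p. restrict p {..<n}) A"
  proof (rule inj_onI)
    fix p q assume pq: "p \<in> A" "q \<in> A" "restrict p {..<n} = restrict q {..<n}"
    show "p = q"
    proof
      fix x
      show "p x = q x"
      proof (cases "x < n")
        case True
        then show ?thesis using fun_cong[OF pq(3), of x] by simp
      next
        case False
        then show ?thesis
          using pq(1,2) permutes_not_in[of p "{..<n}" x] permutes_not_in[of q "{..<n}" x] by (simp add: A_def)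
      qed
    qed
  qed
  moreover have "(\<lambda>p. restrict p {..<n}) ` A \<subseteq> Q"
  proof (intro image_subsetI)
    fix p assume "p \<in> A"
    then have "p permutes {..<n}" "\<forall>x<n. R x (p x)" by (auto simp: A_def)
    then have "p x < n \<and> R x (p x)" if "x < n" for x
      using that permutes_in_image[of p "{..<n}" x] by simp
    then show "restrict p {..<n} \<in> Q" by (simp add: Q_def PiE_iff extensional_def)
  qed
  moreover have "finite Q" unfolding Q_def by (intro finite_PiE) auto
  ultimately have "card A \<le> card Q" by (rule card_inj_on_le)
  then have "real (card A) \<le> (\<Prod>x<n. real (card {y. y < n \<and> R x y}))"
    by (simp add: Q_def card_PiE flip: of_nat_prod)
  also have "\<dots> \<le> (\<Prod>x<n. \<Delta>)" using assms by (intro prod_mono) auto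
  finally show ?thesis by (simp add: A_def)
qed

text \<open>Each permutation is compatible with a code whose candidate lists have length at most
  \<open>\<Delta>\<close>, and such a code is compatible with at most \<open>\<Delta> ^ n\<close>
  permutations.\<close>

lemma fact_le_if_reduces_to_dim:
  fixes \<alpha> :: real and n k r :: nat
  assumes red: "reduces_to_dim TYPE(linfty) n \<alpha> k" and "0 < \<alpha>"
  defines "\<Delta> \<equiv> (42 * \<alpha> / (r + 1) + 1) ^ k * 5 ^ r"
  shows "fact n \<le> (5 ^ k) ^ n * real (4 * n + 1) ^ (45 ^ k) * \<Delta> ^ n"
proof -
  define G where "G = {w \<in> codes n k. \<forall>x<n. real (card {y. y < n \<and> near n k w x y}) \<le> \<Delta>}"
  define A where "A w = {p. p permutes {..<n} \<and> (\<forall>x<n. near n k w x (p x))}" for w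
  have finG: "finite G" using finite_codes by (simp add: G_def)
  have "A w \<subseteq> {p. p permutes {..<n}}" for w by (auto simp: A_def)
  then have finA: "finite (A w)" for w by (rule finite_subset) (simp add: finite_permutations)
  have \<Delta>: "0 \<le> \<Delta>" using \<open>0 < \<alpha>\<close> by (simp add: \<Delta>_def)
  have "{p. p permutes {..<n}} \<subseteq> (\<Union>w\<in>G. A w)"
    using exists_good_code[OF red \<open>0 < \<alpha>\<close>, of _ r] unfolding G_def A_def \<Delta>_def by blast
  then have "card {p. p permutes {..<n}} \<le> card (\<Union>w\<in>G. A w)"
    using finG finA by (intro card_mono) auto
  also have "\<dots> \<le> (\<Sum>w\<in>G. card (A w))" using finG by (rule card_UN_le)
  also have "card {p. p permutes {..<n}} = fact n" by (rule card_permutations) auto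
  finally have "real (fact n) \<le> real (\<Sum>w\<in>G. card (A w))" by (simp only: of_nat_le_iff)
  then have "fact n \<le> (\<Sum>w\<in>G. real (card (A w)))" by simp
  also have "\<dots> \<le> (\<Sum>w\<in>G. \<Delta> ^ n)"
    unfolding A_def by (intro sum_mono card_restricted_permutations) (auto simp: G_def)
  also have "\<dots> = real (card G) * \<Delta> ^ n" by simp
  also have "\<dots> \<le> real (card (codes n k)) * \<Delta> ^ n"
    using \<Delta> finite_codes by (intro mult_right_mono) (auto simp: G_def intro!: card_mono)
  finally show ?thesis by (simp add: card_codes)
qed

text \<open>\<open>n ^ n / fact n\<close> is one term of the series of \<open>exp n\<close>.\<close>

lemma ln_fact_ge: "real n * ln n - n \<le> ln (fact n)"
proof (cases "n = 0")
  case False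
  have "real n ^ n / fact n \<le> exp n"
  proof -
    have s: "(\<lambda>i. real n ^ i /\<^sub>R fact i) sums exp n" by (rule exp_converges)
    have "(\<Sum>i\<in>{n}. real n ^ i /\<^sub>R fact i) \<le> (\<Sum>i. real n ^ i /\<^sub>R fact i)"
      by (rule sum_le_suminf[OF sums_summable[OF s]]) auto
    also have "\<dots> = exp n" by (rule sums_unique[OF s, symmetric])
    finally have "(\<Sum>i\<in>{n}. real n ^ i /\<^sub>R fact i) \<le> exp n" .
    then show ?thesis by (simp add: divide_inverse mult.commute)
  qed
  then have "ln (real n ^ n / fact n) \<le> ln (exp n)" using False by (subst ln_le_cancel_iff) auto
  then show ?thesis using False by (simp add: ln_div ln_realpow)
qed simp

lemma exp_bounds: "5 \<le> exp (2::real)" "45 \<le> exp (6::real)"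
proof -
  show e2: "5 \<le> exp (2::real)" using exp_lower_Taylor_quadratic[of 2] by simp
  have "(45::real) \<le> 5 ^ 3" by simp
  also have "\<dots> \<le> exp 2 ^ 3" using e2 by (intro power_mono) auto
  also have "\<dots> = exp (6::real)" by (simp flip: exp_of_nat_mult)
  finally show "45 \<le> exp (6::real)" .
qed

lemma linfty_lower_bound:
  fixes \<beta> :: real
  assumes "\<beta> > 0"
  shows "\<exists>(c::real) (n\<^sub>0::nat). 0 < c \<and> (\<forall>(n::nat) (\<alpha>::real) k. n\<^sub>0 \<le> n \<and> \<beta> * ln (real n) \<le> \<alpha> \<and>
    reduces_to_dim TYPE(linfty) n \<alpha> k \<longrightarrow> c * (ln (real n) / ln (\<alpha> / ln (real n) + 1)) \<le> real k)"
proof -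
  define g where "g = ln (\<beta> + 1)"
  have g: "0 < g" using assms by (simp add: g_def)
  \<comment> \<open>\<open>2 / g\<close> accounts for \<open>ln 5\<close>, as
    \<open>ln (K + 1) \<ge> g\<close>, and \<open>336 = 42 * 8\<close> for \<open>ln q\<close>, by
    Bernoulli's inequality.\<close>
  define a where "a = 2 / g + 336"
  have a: "0 < a" using g by (simp add: a_def add_pos_pos)
  \<comment> \<open>The first bound limits labels and nets to a factor \<open>exp (L / 8)\<close>
    per vertex, the second limits the factor \<open>45 ^ k\<close> in the table size to
    \<open>sqrt n\<close>.\<close>
  define c where "c = min (1 / (8 * a)) (g / 12)"
  have c: "0 < c" "c \<le> 1 / (8 * a)" "c \<le> g / 12" using g a by (auto simp: c_def)
  \<comment> \<open>This contradicts the final estimate, in which \<open>n * ln n - n\<close> is at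
    most \<open>3 / 8 * n * ln n\<close> plus the contribution of the table.\<close>
  have "eventually (\<lambda>n::nat. exp (ln (real n) / 2) * ln (4 * real n + 1) + real n < 5 / 8 * (real n * ln (real n))) at_top"
    by real_asymp
  then obtain m :: nat where m: "\<And>n. m \<le> n \<Longrightarrow> exp (ln (real n) / 2) * ln (4 * real n + 1) + real n < 5 / 8 * (real n * ln (real n))"
    unfolding eventually_at_top_linorder by blast
  show ?thesis
  proof (rule exI[of _ c], rule exI[of _ "max m 2"], intro conjI allI impI)
    fix n k :: nat and \<alpha> :: real
    assume asm: "max m 2 \<le> n \<and> \<beta> * ln (real n) \<le> \<alpha> \<and> reduces_to_dim TYPE(linfty) n \<alpha> k"
    define L where "L = ln (real n)"
    define K where "K = \<alpha> / L"
    define l where "l = ln (K + 1)"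
    have n: "2 \<le> n" using asm by simp
    have L: "0 < L" using n by (simp add: L_def)
    have \<alpha>: "\<alpha> = K * L" using L by (simp add: K_def)
    have K: "\<beta> \<le> K" using asm L by (simp add: K_def L_def field_simps)
    have K0: "0 < K" using K assms by simp
    have l: "g \<le> l" using K assms by (simp add: g_def l_def)
    have l0: "0 < l" using g l by linarith
    show "c * (ln (real n) / ln (\<alpha> / ln (real n) + 1)) \<le> real k"
    proof (rule ccontr)
      assume "\<not> ?thesis"
      then have "k < c * (L / l)" by (simp add: L_def K_def l_def)
      then have kl: "k * l < c * L" using l0 by (simp add: field_simps)
      have kL: "6 * real k \<le> L / 2"
      proof -
        have "k * g \<le> k * l" using l by (intro mult_left_mono) auto
        also have "\<dots> \<le> g / 12 * L" using kl c(3) L mult_right_mono[of c "g / 12" L] by linarith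
        finally have "g * real k \<le> g * (L / 12)" by (simp add: mult.commute)
        then show ?thesis using g by simp
      qed
      \<comment> \<open>Graph balls of radius \<open>r\<close> have at most
        \<open>5 ^ r \<le> exp (L / 4)\<close> vertices, while \<open>\<alpha> / (r + 1)\<close>
        falls to at most \<open>8 * K\<close>.\<close>
      define r where "r = nat \<lfloor>L / 8\<rfloor>"
      have r: "real r \<le> L / 8" "L / 8 \<le> r + 1" using L unfolding r_def by linarith+
      define q where "q = 42 * \<alpha> / (r + 1) + 1"
      have \<alpha>0: "0 < \<alpha>" using K0 L by (simp add: \<alpha>)
      have q1: "1 \<le> q" using \<alpha>0 by (simp add: q_def)
      have "42 * \<alpha> / (r + 1) \<le> 42 * \<alpha> / (L / 8)"
        using r(2) L \<alpha>0 by (intro divide_left_mono) auto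
      also have "\<dots> = 336 * K" using L by (simp add: \<alpha>)
      finally have "q \<le> 1 + real 336 * K" by (simp add: q_def)
      also have "\<dots> \<le> (1 + K) ^ 336" using K0 by (intro Bernoulli_inequality) simp
      finally have "ln q \<le> ln ((1 + K) ^ 336)" using q1 K0 by (subst ln_le_cancel_iff) auto
      then have lq: "ln q \<le> 336 * l" using K0 by (simp add: ln_realpow l_def add.commute)
      have ln5: "ln 5 \<le> (2::real)" using exp_bounds(1) ln_le_cancel_iff[of 5 "exp 2"] by simp
      have "(2 + ln q) * k \<le> a * (l * k)"
      proof -
        have "2 \<le> 2 / g * l" using l g by (simp add: field_simps)
        then have "2 + ln q \<le> a * l" using lq by (simp add: a_def algebra_simps)
        then show ?thesis by (simp add: mult_right_mono flip: mult.assoc)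
      qed
      also have "\<dots> \<le> a * (1 / (8 * a) * L)"
        using kl L a mult_right_mono[OF c(2), of L] by (intro mult_left_mono) (auto simp: mult.commute)
      also have "\<dots> = L / 8" using a by simp
      finally have kq: "(2 + ln q) * k \<le> L / 8" .
      have "real (45 ^ k) \<le> exp 6 ^ k" using exp_bounds(2) by (simp add: power_mono)
      also have "\<dots> = exp (6 * k)" by (simp add: mult.commute flip: exp_of_nat_mult)
      also have "\<dots> \<le> exp (L / 2)" using kL by simp
      finally have k45: "real (45 ^ k) \<le> exp (L / 2)" .
      have "fact n \<le> (5 ^ k) ^ n * real (4 * n + 1) ^ (45 ^ k) * (q ^ k * 5 ^ r) ^ n"
        using fact_le_if_reduces_to_dim[of n \<alpha> k r] asm \<alpha>0 by (simp add: q_def)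
      then have "ln (fact n) \<le> ln ((5 ^ k) ^ n * real (4 * n + 1) ^ (45 ^ k) * (q ^ k * 5 ^ r) ^ n)"
        using q1 by (subst ln_le_cancel_iff) (auto intro!: mult_pos_pos)
      also have "\<dots> = n * (k * ln 5) + real (45 ^ k) * ln (4 * real n + 1) + n * (k * ln q + r * ln 5)"
        using q1 by (simp add: ln_mult ln_realpow)
      also have "\<dots> = n * ((ln 5 + ln q) * k + r * ln 5) + real (45 ^ k) * ln (4 * real n + 1)"
        by (simp add: algebra_simps)
      also have "\<dots> \<le> n * (L / 8 + L / 4) + exp (L / 2) * ln (4 * real n + 1)"
      proof (intro add_mono mult_mono)
        have "(ln 5 + ln q) * k \<le> (2 + ln q) * k" using ln5 by (intro mult_right_mono) auto
        then show "(ln 5 + ln q) * k \<le> L / 8" using kq by linarith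
        have "r * ln 5 \<le> L / 8 * 2" using r(1) ln5 L by (intro mult_mono) auto
        then show "r * ln 5 \<le> L / 4" by simp
      qed (use k45 q1 in auto)
      finally have "n * L - n \<le> n * (L / 8 + L / 4) + exp (L / 2) * ln (4 * real n + 1)"
        using ln_fact_ge[of n] by (simp add: L_def)
      then have "5 / 8 * (n * L) \<le> exp (L / 2) * ln (4 * real n + 1) + n" by (simp add: algebra_simps)
      moreover have "m \<le> n" using asm by simp
      ultimately show False using m[of n] unfolding L_def by linarith
    qed
  qed (use c in simp)
qed

theorem theorem1p3:
  fixes \<beta> :: real
  assumes "\<beta> > 0"
  shows "\<exists>(c::real) (C::real) (n\<^sub>0::nat). 0 < c \<and> c \<le> C \<and>
    (\<forall>(n::nat) (\<alpha>::real). n \<ge> n\<^sub>0 \<and> \<beta> * ln (real n) \<le> \<alpha> \<and> \<alpha> \<le> real n \<longrightarrow>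
       c * (ln (real n) / ln (\<alpha> / ln (real n) + 1))
         \<le> real (dim_reduction_modulus TYPE(linfty) n \<alpha>) \<and>
       real (dim_reduction_modulus TYPE(linfty) n \<alpha>)
         \<le> C * (ln (real n) / ln (\<alpha> / ln (real n) + 1)))"
proof -
  obtain C :: real and n1 :: nat where upper: "\<forall>(n::nat) (\<alpha>::real). n1 \<le> n \<and> \<beta> * ln (real n) \<le> \<alpha> \<and> \<alpha> \<le> real n \<longrightarrow>
    (\<exists>k. reduces_to_dim TYPE(linfty) n \<alpha> k \<and> real k \<le> C * (ln (real n) / ln (\<alpha> / ln (real n) + 1)))"
    using linfty_upper_bound[OF assms] by (elim exE)
  obtain c :: real and n2 :: nat where c: "0 < c" and lower: "\<forall>(n::nat) (\<alpha>::real) k. n2 \<le> n \<and> \<beta> * ln (real n) \<le> \<alpha> \<and>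
    reduces_to_dim TYPE(linfty) n \<alpha> k \<longrightarrow> c * (ln (real n) / ln (\<alpha> / ln (real n) + 1)) \<le> real k"
    using linfty_lower_bound[OF assms] by (elim exE conjE)
  show ?thesis
  \<comment> \<open>\<open>max c C\<close> secures \<open>c \<le> C\<close>, and the bound 2 on
    \<open>n\<close> makes \<open>ln n\<close> positive.\<close>
  proof (rule exI[of _ c], rule exI[of _ "max c C"], rule exI[of _ "max 2 (max n1 n2)"], intro conjI[OF c] conjI allI impI)
    fix n :: nat and \<alpha> :: real
    assume asm: "max 2 (max n1 n2) \<le> n \<and> \<beta> * ln (real n) \<le> \<alpha> \<and> \<alpha> \<le> real n"
    let ?q = "ln (real n) / ln (\<alpha> / ln (real n) + 1)"
    let ?k = "dim_reduction_modulus TYPE(linfty) n \<alpha>"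
    have n: "2 \<le> n" "n1 \<le> n" "n2 \<le> n" using asm by simp_all
    obtain k where k: "reduces_to_dim TYPE(linfty) n \<alpha> k" "real k \<le> C * ?q"
      using upper n asm by blast
    \<comment> \<open>The upper bound supplies a witness, so the minimum is attained and the lower
      bound applies to it.\<close>
    have least: "reduces_to_dim TYPE(linfty) n \<alpha> ?k" "?k \<le> k"
      unfolding dim_reduction_modulus_def using k(1) by (auto intro: LeastI Least_le)
    show "c * ?q \<le> real ?k" using lower n asm least(1) by blast
    have L: "0 < ln (real n)" using n(1) by simp
    then have "0 < \<alpha>" using asm assms by (meson less_le_trans mult_pos_pos)
    then have q: "0 \<le> ?q" using L by simp
    have "real ?k \<le> C * ?q" using least(2) k(2) by linarith
    also have "\<dots> \<le> max c C * ?q" using q by (intro mult_right_mono) auto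
    finally show "real ?k \<le> max c C * ?q" .
  qed simp
qed

end
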